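(* For $\ell\ge1$, let $\mathscr{A}$ be the toric arrangement in $(\mathbb{S}^1)^\ell$ consisting of the hypertori $\{t_i=1\}$ ($1\le i\le\ell$), $\{t_it_j=1\}$ and $\{t_it_j^{-1}=1\}$ ($1\le i<j\le\ell$) (the arrangement of $\Phi^+(B_\ell)$ with respect to the integer lattice). Then $\mathscr{A}$ is supersolvable if and only if $\ell\le2$.
   Context: The poset of layers $L(\mathscr{A})$ consists of connected components of nonempty intersections of subsets of $\mathscr{A}$ (empty intersection $=(\mathbb{S}^1)^\ell$), ordered by reverse inclusion, with rank $=$ codimension; $\mathscr{A}$ is supersolvable if $L(\mathscr{A})$ is. For a finite ranked poset $\mathcal{P}$ with minimum $\hat0$ in which each $\mathcal{P}_{\le x}$ is a geometric lattice (a lattice where $y$ covers $x$ iff $y=x\vee a$ for some atom $a\not\le x$): $\bigvee T$ denotes the set of minimal upper bounds of $T$; an element $y$ of a geometric lattice $L$ is modular if $y\wedge(w\vee z)=(y\wedge w)\vee z$ for all $z\le y$, $w\in L$; an M-ideal of $\mathcal{P}$ is a pure (all maximal elements of equal rank), join-closed ($T\subseteq\mathcal{Q}\Rightarrow\bigvee T\subseteq\mathcal{Q}$) order ideal $\mathcal{Q}$ such that (1) every atom $a\notin\mathcal{Q}$ and $y\in\mathcal{Q}$ have at least one minimal upper bound, and (2) for every maximal $x\in\mathcal{P}$ some maximal $y\in\mathcal{Q}$ is modular in $\mathcal{P}_{\le x}$; $\mathcal{P}$ is supersolvable if there is a chain $\{\hat0\}=\mathcal{Q}_0\subsetneq\mathcal{Q}_1\subsetneq\cdots\subsetneq\mathcal{Q}_r=\mathcal{P}$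 with each $\mathcal{Q}_i$ an M-ideal of $\mathcal{Q}_{i+1}$ and $\operatorname{rk}(\mathcal{Q}_i)=i$. *)

theory Defs
  imports "HOL-Analysis.Analysis"
begin

definition is_chain :: "('a \<Rightarrow> 'a \<Rightarrow> bool) \<Rightarrow> 'a set \<Rightarrow> bool" where
  "is_chain le C \<longleftrightarrow> (\<forall>a\<in>C. \<forall>b\<in>C. le a b \<or> le b a)"

text \<open>Rank of x in a finite ranked poset with minimum: length of a longest chain
  from the minimum to x (number of elements minus one).\<close>
definition prank :: "'a set \<Rightarrow> ('a \<Rightarrow> 'a \<Rightarrow> bool) \<Rightarrow> 'a \<Rightarrow> nat" where
  "prank P le x = Max {card C | C. C \<subseteq> P \<and> (\<forall>c\<in>C. le c x) \<and> is_chain le C} - 1"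

definition set_rank :: "'a set \<Rightarrow> ('a \<Rightarrow> 'a \<Rightarrow> bool) \<Rightarrow> 'a set \<Rightarrow> nat" where
  "set_rank P le Q = Max (prank P le ` Q)"

definition maximal_elts :: "'a set \<Rightarrow> ('a \<Rightarrow> 'a \<Rightarrow> bool) \<Rightarrow> 'a set" where
  "maximal_elts Q le = {x\<in>Q. \<forall>y\<in>Q. le x y \<longrightarrow> y = x}"

definition atoms :: "'a set \<Rightarrow> ('a \<Rightarrow> 'a \<Rightarrow> bool) \<Rightarrow> 'a set" where
  "atoms P le = {a\<in>P. prank P le a = 1}"

definition mub :: "'a set \<Rightarrow> ('a \<Rightarrow> 'a \<Rightarrow> bool) \<Rightarrow> 'a set \<Rightarrow> 'a set" where
  "mub P le T = {y\<in>P. (\<forall>t\<in>T. le t y) \<and>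
      (\<forall>y'\<in>P. (\<forall>t\<in>T. le t y') \<and> le y' y \<longrightarrow> y' = y)}"

definition order_ideal :: "'a set \<Rightarrow> ('a \<Rightarrow> 'a \<Rightarrow> bool) \<Rightarrow> 'a set \<Rightarrow> bool" where
  "order_ideal P le Q \<longleftrightarrow> Q \<subseteq> P \<and> (\<forall>x\<in>Q. \<forall>y\<in>P. le y x \<longrightarrow> y \<in> Q)"

definition pure :: "'a set \<Rightarrow> ('a \<Rightarrow> 'a \<Rightarrow> bool) \<Rightarrow> 'a set \<Rightarrow> bool" where
  "pure P le Q \<longleftrightarrow> (\<forall>x\<in>maximal_elts Q le. \<forall>y\<in>maximal_elts Q le.
      prank P le x = prank P le y)"

definition join_closed :: "'a set \<Rightarrow> ('a \<Rightarrow> 'a \<Rightarrow> bool) \<Rightarrow> 'a set \<Rightarrow> bool" where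
  "join_closed P le Q \<longleftrightarrow> (\<forall>T. T \<subseteq> Q \<longrightarrow> mub P le T \<subseteq> Q)"

definition is_lub :: "'a set \<Rightarrow> ('a \<Rightarrow> 'a \<Rightarrow> bool) \<Rightarrow> 'a \<Rightarrow> 'a \<Rightarrow> 'a \<Rightarrow> bool" where
  "is_lub L le a b c \<longleftrightarrow> c \<in> L \<and> le a c \<and> le b c \<and>
      (\<forall>d\<in>L. le a d \<and> le b d \<longrightarrow> le c d)"

definition is_glb :: "'a set \<Rightarrow> ('a \<Rightarrow> 'a \<Rightarrow> bool) \<Rightarrow> 'a \<Rightarrow> 'a \<Rightarrow> 'a \<Rightarrow> bool" where
  "is_glb L le a b c \<longleftrightarrow> c \<in> L \<and> le c a \<and> le c b \<and>
      (\<forall>d\<in>L. le d a \<and> le d b \<longrightarrow> le d c)"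

definition modular_elt :: "'a set \<Rightarrow> ('a \<Rightarrow> 'a \<Rightarrow> bool) \<Rightarrow> 'a \<Rightarrow> bool" where
  "modular_elt L le y \<longleftrightarrow> y \<in> L \<and>
     (\<forall>w\<in>L. \<forall>z\<in>L. le z y \<longrightarrow>
        (\<forall>u v m n. is_lub L le w z u \<longrightarrow> is_glb L le y u v \<longrightarrow>
                   is_glb L le y w m \<longrightarrow> is_lub L le m z n \<longrightarrow> v = n))"

definition below :: "'a set \<Rightarrow> ('a \<Rightarrow> 'a \<Rightarrow> bool) \<Rightarrow> 'a \<Rightarrow> 'a set" where
  "below P le x = {z\<in>P. le z x}"

definition M_ideal :: "'a set \<Rightarrow> ('a \<Rightarrow> 'a \<Rightarrow> bool) \<Rightarrow> 'a set \<Rightarrow> bool" where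
  "M_ideal P le Q \<longleftrightarrow>
     order_ideal P le Q \<and> pure P le Q \<and> join_closed P le Q \<and>
     (\<forall>a\<in>atoms P le. a \<notin> Q \<longrightarrow> (\<forall>y\<in>Q. mub P le {a, y} \<noteq> {})) \<and>
     (\<forall>x\<in>maximal_elts P le. \<exists>y\<in>maximal_elts Q le.
        le y x \<and> modular_elt (below P le x) le y)"

definition supersolvable_poset :: "'a set \<Rightarrow> ('a \<Rightarrow> 'a \<Rightarrow> bool) \<Rightarrow> bool" where
  "supersolvable_poset P le \<longleftrightarrow>
     (\<exists>Qs :: nat \<Rightarrow> 'a set. \<exists>r.
        Qs 0 = {x\<in>P. \<forall>y\<in>P. le x y} \<and> Qs r = P \<and>
        (\<forall>i<r. Qs i \<subset> Qs (Suc i) \<and> M_ideal (Qs (Suc i)) le (Qs i)) \<and>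
        (\<forall>i\<le>r. set_rank P le (Qs i) = i))"

text \<open>The compact torus (S^1)^l, realised as points t :: nat => complex with
  |t i| = 1 for i < l and t i = 1 for i >= l (product topology).\<close>
definition torus :: "nat \<Rightarrow> (nat \<Rightarrow> complex) set" where
  "torus l = {t. (\<forall>i<l. cmod (t i) = 1) \<and> (\<forall>i\<ge>l. t i = 1)}"

text \<open>The toric arrangement of the positive roots of B_l w.r.t. the integer lattice.\<close>
definition arrB :: "nat \<Rightarrow> (nat \<Rightarrow> complex) set set" where
  "arrB l =
     {{t\<in>torus l. t i = 1} | i. i < l} \<union>
     {{t\<in>torus l. t i * t j = 1} | i j. i < j \<and> j < l} \<union>
     {{t\<in>torus l. t i * inverse (t j) = 1} | i j. i < j \<and> j < l}"

definition layers :: "nat \<Rightarrow> (nat \<Rightarrow> complex) set set \<Rightarrow> (nat \<Rightarrow> complex) set set" where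
  "layers l A = {C. \<exists>B\<subseteq>A. \<exists>x\<in>torus l \<inter> \<Inter>B.
                    C = connected_component_set (torus l \<inter> \<Inter>B) x}"

definition layer_le :: "(nat \<Rightarrow> complex) set \<Rightarrow> (nat \<Rightarrow> complex) set \<Rightarrow> bool" where
  "layer_le X Y \<longleftrightarrow> Y \<subseteq> X"

definition supersolvable_toric :: "nat \<Rightarrow> (nat \<Rightarrow> complex) set set \<Rightarrow> bool" where
  "supersolvable_toric l A \<longleftrightarrow> supersolvable_poset (layers l A) layer_le"

end

theory Submission
  imports Defs
begin

text \<open>
  Suppose \<open>l \<ge> 3\<close> and let \<open>Q\<close> be the last proper M-ideal of a supersolvable chain. A modular
  maximal element of \<open>Q\<close> below the point \<open>(1, \<dots>, 1)\<close> is a line for rank reasons, and the only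
  modular lines there are the coordinate lines \<open>{t_i = 1 for i \<noteq> k}\<close>. Since \<open>Q\<close> is join-closed and
  proper, its hypersurfaces are then exactly those not involving \<open>t_k\<close>, which forces
  \<open>{t_i = -1 for i \<noteq> k}\<close> to be the maximal element of \<open>Q\<close> below the point \<open>(-1, \<dots>, -1)\<close>.
  It is not modular: it has only the whole torus in common with the rank two layer
  \<open>{t_k = t_i = -1}\<close>, because \<open>{t_i = -1}\<close> is not a layer.
  For \<open>l = 2\<close> the chain through the diagonal \<open>{t_0 = t_1}\<close> works, as the diagonal contains both
  points of the layer poset.
\<close>

section \<open>Finite posets\<close>

text \<open>Adjoining \<open>y\<close> to a longest chain below \<open>x\<close> gives a longer
  chain below \<open>y\<close>; antisymmetry keeps \<open>y\<close> out of the old chain. The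
  one-element chain \<open>{x}\<close> makes the maximum at least 1, so the truncated subtraction in
  \<open>prank\<close> loses nothing.\<close>

lemma prank_strict_mono:
  assumes "finite P" "reflp le" "transp le" "antisymp le"
    and "x \<in> P" "y \<in> P" "le x y" "x \<noteq> y"
  shows "prank P le x < prank P le y"
proof -
  let ?K = "\<lambda>z. {card C | C. C \<subseteq> P \<and> (\<forall>c\<in>C. le c z) \<and> is_chain le C}"
  have fin: "finite (?K z)" for z
    by (rule finite_subset[of _ "card ` Pow P"]) (use assms(1) in auto)
  have one: "1 \<in> ?K z" if "z \<in> P" for z
    using that assms(2) by (auto intro!: exI[of _ "{z}"] simp: is_chain_def reflpD)
  have "Max (?K x) \<in> ?K x"
    using fin one[OF assms(5)] by (intro Max_in) auto
  then obtain C where C: "card C = Max (?K x)" "C \<subseteq> P" "\<forall>c\<in>C. le c x" "is_chain le C"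
    by force
  have le_y: "\<forall>c\<in>C. le c y"
    using C(3) assms(7) transpD[OF assms(3)] by blast
  have "y \<notin> C"
    using C(3) assms(7,8) antisympD[OF assms(4)] by blast
  moreover have "finite C"
    using C(2) assms(1) finite_subset by blast
  ultimately have card: "card (insert y C) = Suc (Max (?K x))"
    using C(1) by simp
  have "card (insert y C) \<in> ?K y"
    using C le_y assms(6) reflpD[OF assms(2)]
    by (auto intro!: exI[of _ "insert y C"] simp: is_chain_def)
  then have "Suc (Max (?K x)) \<le> Max (?K y)"
    unfolding card[symmetric] by (rule Max_ge[OF fin])
  moreover have "1 \<le> Max (?K x)"
    using Max_ge[OF fin one[OF assms(5)]] .
  moreover have "Suc a \<le> b \<Longrightarrow> 1 \<le> a \<Longrightarrow> a - 1 < b - 1" for a b :: nat by linarith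
  ultimately show ?thesis
    unfolding prank_def by blast
qed

text \<open>A strictly increasing \<open>f\<close> is injective on a chain below \<open>x\<close>
  and takes values in \<open>{..f x}\<close> there, so such a chain has at most
  \<open>f x + 1\<close> elements. Codimension serves as \<open>f\<close> when the small posets for
  \<open>l = 1\<close> and \<open>l = 2\<close> are treated.\<close>

lemma prank_le_height:
  fixes f :: "'a \<Rightarrow> nat"
  assumes "finite P" "\<And>u v. u \<in> P \<Longrightarrow> v \<in> P \<Longrightarrow> le u v \<Longrightarrow> u \<noteq> v \<Longrightarrow> f u < f v" "x \<in> P"
  shows "prank P le x \<le> f x"
proof -
  let ?K = "{card C | C. C \<subseteq> P \<and> (\<forall>c\<in>C. le c x) \<and> is_chain le C}"
  have fin: "finite ?K"
    by (rule finite_subset[of _ "card ` Pow P"]) (use assms(1) in auto)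
  have ne: "0 \<in> ?K"
    by (auto intro!: exI[of _ "{}"] simp: is_chain_def)
  have "k \<le> Suc (f x)" if k: "k \<in> ?K" for k
  proof -
    obtain C where C: "k = card C" "C \<subseteq> P" "\<forall>c\<in>C. le c x" "is_chain le C"
      using k by blast
    have "inj_on f C"
      using C(2,4) assms(2) unfolding inj_on_def is_chain_def
      by (metis less_irrefl subsetD)
    moreover have "f ` C \<subseteq> {..f x}"
      using C(2,3) assms(2)[OF _ assms(3)] by (metis atMost_iff image_subsetI less_imp_le order_refl subsetD)
    ultimately show ?thesis
      using C(1) card_inj_on_le[of f C "{..f x}"] by simp
  qed
  then have "Max ?K \<le> Suc (f x)"
    using Max_in[OF fin] ne by blast
  then show ?thesis
    unfolding prank_def by (simp only: le_diff_conv Suc_eq_plus1)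
qed

text \<open>For \<open>z = y\<close> both sides of the modular law collapse to \<open>y\<close>; for
  \<open>z = b\<close> both are the meet of \<open>y\<close> and \<open>w\<close>.\<close>

lemma modular_elt_if_atom_or_bottom:
  assumes "reflp le" "antisymp le" "b \<in> L" "\<And>u. u \<in> L \<Longrightarrow> le b u"
    and "y \<in> L" "\<And>z. z \<in> L \<Longrightarrow> le z y \<Longrightarrow> z = y \<or> z = b"
  shows "modular_elt L le y"
  unfolding modular_elt_def
proof (intro conjI ballI allI impI)
  fix w z u v m n
  assume wz: "w \<in> L" "z \<in> L" "le z y" and u: "is_lub L le w z u" and v: "is_glb L le y u v"
    and m: "is_glb L le y w m" and n: "is_lub L le m z n"
  note r = reflpD[OF assms(1)] and a = antisympD[OF assms(2)]
  consider "z = y" | "z = b" using assms(6) wz by blast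
  then show "v = n"
  proof cases
    case 1
    then have "v = y" using u v assms(5) r a unfolding is_lub_def is_glb_def by blast
    moreover have "n = y" using 1 m n assms(5) r a unfolding is_lub_def is_glb_def by blast
    ultimately show ?thesis by simp
  next
    case 2
    then have "u = w" using u wz assms(4) r a unfolding is_lub_def by blast
    then have "v = m" using v m a unfolding is_glb_def by blast
    moreover have "n = m" using 2 n m assms(4) r a unfolding is_lub_def is_glb_def by blast
    ultimately show ?thesis by simp
  qed
qed (fact assms(5))

text \<open>First step of the chains for \<open>l = 1\<close> and \<open>l = 2\<close>. Since
  \<open>b\<close> is an upper bound of every \<open>T \<subseteq> {b}\<close>, the empty
  \<open>T\<close> included, minimality leaves no other member of \<open>mub P le T\<close>.\<close>

lemma M_ideal_bottom:
  assumes "reflp le" "antisymp le" "b \<in> P" "\<And>u. u \<in> P \<Longrightarrow> le b u"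
  shows "M_ideal P le {b}"
proof -
  note r = reflpD[OF assms(1)] and a = antisympD[OF assms(2)]
  have "mub P le T \<subseteq> {b}" if "T \<subseteq> {b}" for T
    using that assms(3,4) r unfolding mub_def by blast
  moreover have "c \<in> mub P le {c, b}" if "c \<in> P" for c
    using that assms(4) r a unfolding mub_def by blast
  moreover have "modular_elt (below P le x) le b" if "x \<in> P" for x
    by (rule modular_elt_if_atom_or_bottom[OF assms(1,2), where b = b])
      (use that assms(3,4) a in \<open>auto simp: below_def\<close>)
  moreover have "order_ideal P le {b}"
    using assms(3,4) a unfolding order_ideal_def by blast
  ultimately show ?thesis
    using assms(3,4)
    unfolding M_ideal_def pure_def join_closed_def maximal_elts_def atoms_def
    by blast
qed

lemma exists_maximal_above:
  assumes "finite Q" "reflp le" "transp le" "antisymp le" "q \<in> Q"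
  shows "\<exists>m\<in>maximal_elts Q le. le q m"
proof -
  let ?U = "{m\<in>Q. le q m}"
  have fin: "finite (prank Q le ` ?U)" using assms(1) by simp
  have "Max (prank Q le ` ?U) \<in> prank Q le ` ?U"
    using fin assms(5) reflpD[OF assms(2)] by (intro Max_in) blast+
  then obtain m where m: "m \<in> ?U" and "prank Q le m = Max (prank Q le ` ?U)"
    by force
  then have max: "prank Q le m' \<le> prank Q le m" if "m' \<in> ?U" for m'
    using Max_ge[OF fin] that by simp
  have "m' = m" if "m' \<in> Q" "le m m'" for m'
  proof (rule ccontr)
    assume "m' \<noteq> m"
    then have "prank Q le m < prank Q le m'"
      using prank_strict_mono[OF assms(1-4)] m that by blast
    moreover have "le q m'"
      using m that transpD[OF assms(3)] by blast
    ultimately show False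
      using max[of m'] that by simp
  qed
  then show ?thesis
    using m unfolding maximal_elts_def by blast
qed

section \<open>Layers\<close>

lemma layer_le_order: "reflp layer_le" "transp layer_le" "antisymp layer_le"
  by (auto simp: layer_le_def reflp_def transp_def antisymp_def)

text \<open>\<open>C\<close> is recovered as the component through \<open>p\<close> of the
  intersection of all members of \<open>A\<close> containing it. The last premise is applied with
  that whole component as \<open>D\<close>.\<close>

lemma layersI:
  assumes "connected C" "p \<in> C" "C \<subseteq> torus l"
    and "\<And>D t. connected D \<Longrightarrow> p \<in> D \<Longrightarrow> t \<in> D \<Longrightarrow> D \<subseteq> torus l \<Longrightarrow>
      (\<And>H. H \<in> A \<Longrightarrow> C \<subseteq> H \<Longrightarrow> D \<subseteq> H) \<Longrightarrow> t \<in> C"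
  shows "C \<in> layers l A"
proof -
  define B where "B = {H\<in>A. C \<subseteq> H}"
  have C: "C \<subseteq> torus l \<inter> \<Inter>B" using assms(3) B_def by auto
  have "connected_component_set (torus l \<inter> \<Inter>B) p \<subseteq> C"
  proof
    fix t assume t: "t \<in> connected_component_set (torus l \<inter> \<Inter>B) p"
    have sub: "connected_component_set (torus l \<inter> \<Inter>B) p \<subseteq> torus l \<inter> \<Inter>B"
      by (rule connected_component_subset)
    show "t \<in> C"
      by (rule assms(4)[OF connected_connected_component _ t])
        (use sub C assms(2) in \<open>auto simp: B_def\<close>)
  qed
  moreover have "C \<subseteq> connected_component_set (torus l \<inter> \<Inter>B) p"
    by (rule connected_component_maximal) (use assms C in auto)
  ultimately have "C = connected_component_set (torus l \<inter> \<Inter>B) p" by blast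
  moreover have "B \<subseteq> A" using B_def by auto
  ultimately show ?thesis
    using C assms(2) unfolding layers_def by blast
qed

lemma layersD:
  assumes "C \<in> layers l A"
  shows "connected C" "C \<noteq> {}" "C \<subseteq> torus l"
proof -
  obtain B x where x: "x \<in> torus l \<inter> \<Inter>B" and C: "C = connected_component_set (torus l \<inter> \<Inter>B) x"
    using assms unfolding layers_def by blast
  have "x \<in> C" using connected_component_refl[OF x] unfolding C by simp
  then show "C \<noteq> {}" by blast
  show "connected C" "C \<subseteq> torus l"
    using connected_component_subset[of "torus l \<inter> \<Inter>B" x] unfolding C by auto
qed

text \<open>\<open>C\<close> is a full component of an intersection of members of \<open>A\<close>;
  all of these contain \<open>C\<close>, hence \<open>D\<close>, and \<open>D\<close> is connected
  and meets \<open>C\<close>. Comparing layers that share a point thus reduces to comparing the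
  hypersurfaces containing them.\<close>

lemma layers_absorb:
  assumes "C \<in> layers l A" "connected D" "x \<in> C" "x \<in> D" "D \<subseteq> torus l"
    and "\<And>H. H \<in> A \<Longrightarrow> C \<subseteq> H \<Longrightarrow> D \<subseteq> H"
  shows "D \<subseteq> C"
proof -
  obtain B p where B: "B \<subseteq> A" and C: "C = connected_component_set (torus l \<inter> \<Inter>B) p"
    using assms(1) unfolding layers_def by blast
  have "C \<subseteq> torus l \<inter> \<Inter>B"
    unfolding C by (rule connected_component_subset)
  then have "D \<subseteq> torus l \<inter> \<Inter>B"
    using assms(5,6) B by blast
  moreover have "C = connected_component_set (torus l \<inter> \<Inter>B) x"
    using assms(3) C by (metis connected_component_eq)
  ultimately show ?thesis
    using connected_component_maximal[OF assms(4,2)] by blast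
qed

text \<open>\<open>C\<close> is a minimal upper bound of the set of hypersurfaces containing it: a
  larger layer inside the same hypersurfaces is absorbed by \<open>C\<close>.\<close>

lemma layer_in_join_closed:
  assumes "join_closed (layers l A) layer_le Q" "C \<in> layers l A"
    and "\<And>H. H \<in> A \<Longrightarrow> C \<subseteq> H \<Longrightarrow> H \<in> Q"
  shows "C \<in> Q"
proof -
  have "D = C" if "D \<in> layers l A" "\<And>H. H \<in> A \<Longrightarrow> C \<subseteq> H \<Longrightarrow> D \<subseteq> H" "C \<subseteq> D" for D
  proof -
    obtain x where "x \<in> C" using layersD(2)[OF assms(2)] by blast
    then have "D \<subseteq> C"
      using layers_absorb[OF assms(2) layersD(1)[OF that(1)], of x] that layersD(3)[OF that(1)]
      by blast
    with that show ?thesis by blast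
  qed
  then have "C \<in> mub (layers l A) layer_le {H\<in>A. C \<subseteq> H}"
    using assms(2) unfolding mub_def layer_le_def by blast
  moreover have "{H\<in>A. C \<subseteq> H} \<subseteq> Q" using assms(3) by blast
  ultimately show ?thesis
    using assms(1)[unfolded join_closed_def, rule_format] by blast
qed

section \<open>Connected sets with discrete coordinates, and rotation paths\<close>

lemma connected_discrete_coordinate:
  fixes D :: "(nat \<Rightarrow> complex) set"
  assumes "connected D" "p \<in> D" "t \<in> D" "\<And>u. u \<in> D \<Longrightarrow> u i \<in> {1, -1}"
  shows "t i = p i"
proof -
  have "connected ((\<lambda>u. u i) ` D)"
    using assms(1) continuous_on_subset[OF continuous_on_product_coordinates]
    by (intro connected_continuous_image) auto
  moreover have "finite ((\<lambda>u. u i) ` D)"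
    by (rule finite_subset[of _ "{1, -1}"]) (use assms(4) in blast, simp)
  ultimately obtain z where "(\<lambda>u. u i) ` D \<subseteq> {z}"
    by (metis connected_finite_iff_sing empty_subsetI order_refl)
  then show ?thesis using assms(2,3) by blast
qed

lemma connected_discrete_singleton:
  fixes D :: "(nat \<Rightarrow> complex) set"
  assumes "connected D" "p \<in> D" "\<And>u i. u \<in> D \<Longrightarrow> u i \<in> {1, -1}"
  shows "D = {p}"
proof -
  have "t = p" if "t \<in> D" for t
    using connected_discrete_coordinate[OF assms(1,2) that] assms(3) by (intro ext) blast
  then show ?thesis using assms(2) by blast
qed

lemma connected_component_rotation:
  fixes p :: "nat \<Rightarrow> complex"
  assumes "\<And>s. s \<in> {0..1::real} \<Longrightarrow> (\<lambda>i. p i * cis (s * \<theta> i)) \<in> S"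
  shows "connected_component S p (\<lambda>i. p i * cis (\<theta> i))"
proof -
  let ?g = "\<lambda>(s::real) i. p i * cis (s * \<theta> i)"
  have "continuous_on {0..1} ?g"
    by (intro continuous_on_coordinatewise_then_product continuous_intros)
  then have "connected (?g ` {0..1})"
    by (intro connected_continuous_image) auto
  moreover have "?g ` {0..1} \<subseteq> S" using assms by blast
  moreover have "p \<in> ?g ` {0..1}" by (rule image_eqI[of _ _ 0]) auto
  moreover have "(\<lambda>i. p i * cis (\<theta> i)) \<in> ?g ` {0..1}" by (rule image_eqI[of _ _ 1]) auto
  ultimately show ?thesis unfolding connected_component_def by blast
qed

section \<open>The arrangement of type B\<close>

lemma torus_nonzero: "t \<in> torus l \<Longrightarrow> t i \<noteq> 0"
  unfolding torus_def by (cases "i < l") auto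

lemma cis_Arg_torus: "t \<in> torus l \<Longrightarrow> cis (Arg (t i)) = t i"
  using cis_Arg[of "t i"] torus_nonzero[of t l i] unfolding torus_def
  by (cases "i < l") (auto simp: sgn_eq)

text \<open>Dropping the order \<open>a < b\<close> and writing
  \<open>t a * inverse (t b) = 1\<close> as \<open>t a = t b\<close> lets later case distinctions
  treat the two indices symmetrically.\<close>

lemma arrB_cases [consumes 1, case_names coord prod eq]:
  assumes "H \<in> arrB l"
  obtains (coord) a where "a < l" "H = {t\<in>torus l. t a = 1}"
  | (prod) a b where "a < l" "b < l" "a \<noteq> b" "H = {t\<in>torus l. t a * t b = 1}"
  | (eq) a b where "a < l" "b < l" "a \<noteq> b" "H = {t\<in>torus l. t a = t b}"
proof -
  have *: "{t\<in>torus l. t a * inverse (t b) = 1} = {t\<in>torus l. t a = t b}" for a b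
    using torus_nonzero by (auto simp: field_simps)
  have "(\<exists>a. a < l \<and> H = {t\<in>torus l. t a = 1}) \<or>
    (\<exists>a b. a < b \<and> b < l \<and> H = {t\<in>torus l. t a * t b = 1}) \<or>
    (\<exists>a b. a < b \<and> b < l \<and> H = {t\<in>torus l. t a = t b})"
    using assms unfolding arrB_def * by blast
  then consider
      a where "a < l" "H = {t\<in>torus l. t a = 1}"
    | a b where "a < b" "b < l" "H = {t\<in>torus l. t a * t b = 1}"
    | a b where "a < b" "b < l" "H = {t\<in>torus l. t a = t b}"
    by (elim disjE exE conjE)
  then show ?thesis
  proof cases
    case (1 a)
    then show ?thesis by (rule coord)
  next
    case (2 a b)
    then show ?thesis by (intro prod[of a b]) auto
  next
    case (3 a b)
    then show ?thesis by (intro eq[of a b]) auto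
  qed
qed

lemma arrB_intros:
  shows arrB_coord: "a < l \<Longrightarrow> {t\<in>torus l. t a = 1} \<in> arrB l"
    and arrB_prod: "a < l \<Longrightarrow> b < l \<Longrightarrow> a \<noteq> b \<Longrightarrow> {t\<in>torus l. t a * t b = 1} \<in> arrB l"
    and arrB_eq: "a < l \<Longrightarrow> b < l \<Longrightarrow> a \<noteq> b \<Longrightarrow> {t\<in>torus l. t a = t b} \<in> arrB l"
proof -
  have *: "{t\<in>torus l. t a * inverse (t b) = 1} = {t\<in>torus l. t a = t b}" for a b
    using torus_nonzero by (auto simp: field_simps)
  show "a < l \<Longrightarrow> {t\<in>torus l. t a = 1} \<in> arrB l"
    unfolding arrB_def by blast
  show "{t\<in>torus l. t a * t b = 1} \<in> arrB l" if "a < l" "b < l" "a \<noteq> b"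
  proof (cases "a < b")
    case True
    then show ?thesis using that unfolding arrB_def by blast
  next
    case False
    then have "b < a" "{t\<in>torus l. t a * t b = 1} = {t\<in>torus l. t b * t a = 1}"
      using that by (auto simp: mult.commute)
    then show ?thesis using that unfolding arrB_def by blast
  qed
  show "{t\<in>torus l. t a = t b} \<in> arrB l" if "a < l" "b < l" "a \<noteq> b"
  proof (cases "a < b")
    case True
    then show ?thesis using that unfolding arrB_def * by blast
  next
    case False
    then have "b < a" "{t\<in>torus l. t a = t b} = {t\<in>torus l. t b = t a}"
      using that by auto
    then show ?thesis using that unfolding arrB_def * by blast
  qed
qed

lemma finite_arrB: "finite (arrB l)"
proof -
  have "arrB l \<subseteq> (\<lambda>i. {t\<in>torus l. t i = 1}) ` {..<l}
    \<union> (\<lambda>(i, j). {t\<in>torus l. t i * t j = 1}) ` ({..<l} \<times> {..<l})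
    \<union> (\<lambda>(i, j). {t\<in>torus l. t i * inverse (t j) = 1}) ` ({..<l} \<times> {..<l})"
    unfolding arrB_def by force
  then show ?thesis by (rule finite_subset) auto
qed

text \<open>Contract every coordinate different from \<open>-1\<close> to \<open>1\<close> along its principal argument; this
  respects all equations of the arrangement.\<close>
lemma torsion_point_in_component:
  assumes "B \<subseteq> arrB l" "x \<in> torus l \<inter> \<Inter>B"
  shows "\<exists>p. (\<forall>i. p i \<in> {1, -1}) \<and> p \<in> torus l \<inter> \<Inter>B \<and>
    connected_component (torus l \<inter> \<Inter>B) p x"
proof -
  define p where "p = (\<lambda>i. if x i = -1 then -1 else (1::complex))"
  define \<theta> where "\<theta> = (\<lambda>i. if x i = -1 then 0 else Arg (x i))"
  have x: "x = (\<lambda>i. p i * cis (\<theta> i))"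
    using cis_Arg_torus[of x l] assms(2) by (auto simp: p_def \<theta>_def)
  have *: "(\<lambda>i. p i * cis (s * \<theta> i)) \<in> torus l \<inter> \<Inter>B" (is "?y \<in> _") for s
  proof -
    have xt: "x \<in> torus l" using assms(2) by blast
    have y: "?y \<in> torus l"
      using xt unfolding torus_def by (auto simp: p_def \<theta>_def norm_mult)
    have "?y \<in> H" if H: "H \<in> B" for H
    proof -
      have "H \<in> arrB l" using H assms(1) by blast
      moreover have xH: "x \<in> H" using H assms(2) by blast
      ultimately show ?thesis
      proof (cases rule: arrB_cases)
        case (coord a)
        then show ?thesis using xH y by (simp add: p_def \<theta>_def)
      next
        case (prod a b)
        then have inv: "x b = inverse (x a)"
          using xH by (simp add: inverse_unique[symmetric])
        then have e: "x a = -1 \<longleftrightarrow> x b = -1"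
          by (metis inverse_1 inverse_inverse_eq inverse_minus_eq)
        \<comment> \<open>The principal argument changes sign under inversion except at -1, where it
          is \<open>pi\<close> on both sides. This is why \<open>\<theta>\<close> fixes the
          coordinates equal to -1.\<close>
        have "Arg (x b) = - Arg (x a)" if "x a \<noteq> -1"
        proof -
          have "Arg (x a) < pi"
            using that cis_Arg_torus[OF xt, of a] Arg_le_pi[of "x a"]
            by (metis cis_pi order_le_less)
          moreover have "- pi < Arg (x a)" using mpi_less_Arg .
          ultimately show ?thesis
            using inv cis_Arg_torus[OF xt, of a] Arg_cis[of "- Arg (x a)"]
            by (simp flip: cis_inverse)
        qed
        then have "?y a * ?y b = 1"
          using e by (auto simp: p_def \<theta>_def cis_mult)
        then show ?thesis using prod y by simp
      next
        case (eq a b)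
        then show ?thesis using xH y by (simp add: p_def \<theta>_def)
      qed
    qed
    with y show ?thesis by blast
  qed
  have "connected_component (torus l \<inter> \<Inter>B) p x"
    using connected_component_rotation[of p \<theta>, OF *] x by simp
  moreover have "p \<in> torus l \<inter> \<Inter>B" using *[of 0] by simp
  moreover have "\<forall>i. p i \<in> {1, -1}" by (simp add: p_def)
  ultimately show ?thesis by blast
qed

text \<open>A layer is determined by a set \<open>B\<close> of hypersurfaces and one of its points
  with all entries 1 or -1, and there are finitely many such pairs.\<close>

lemma finite_layers_arrB: "finite (layers l (arrB l))"
proof -
  let ?E = "{p\<in>torus l. \<forall>i. p i \<in> {1, -1}}"
  have "?E \<subseteq> {f. (\<forall>i. (i \<in> {..<l} \<longrightarrow> f i \<in> {1, -1}) \<and> (i \<notin> {..<l} \<longrightarrow> f i = 1))}"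
    unfolding torus_def by auto
  then have "finite ?E"
    by (rule finite_subset) (intro finite_set_of_finite_funs; simp)
  moreover have "layers l (arrB l) \<subseteq>
    (\<lambda>(B, p). connected_component_set (torus l \<inter> \<Inter>B) p) ` (Pow (arrB l) \<times> ?E)"
  proof
    fix C assume "C \<in> layers l (arrB l)"
    then obtain B x where B: "B \<subseteq> arrB l" "x \<in> torus l \<inter> \<Inter>B"
      and C: "C = connected_component_set (torus l \<inter> \<Inter>B) x"
      unfolding layers_def by blast
    obtain p where p: "\<forall>i. p i \<in> {1, -1}" "p \<in> torus l \<inter> \<Inter>B"
      "connected_component (torus l \<inter> \<Inter>B) p x"
      using torsion_point_in_component[OF B] by blast
    have "C = connected_component_set (torus l \<inter> \<Inter>B) p"
      using p(3) C by (metis connected_component_eq mem_Collect_eq)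
    then show "C \<in> (\<lambda>(B, p). connected_component_set (torus l \<inter> \<Inter>B) p) ` (Pow (arrB l) \<times> ?E)"
      using p B by force
  qed
  ultimately show ?thesis
    using finite_arrB by (meson finite_Pow_iff finite_SigmaI finite_imageI finite_subset)
qed

section \<open>Flats\<close>

text \<open>All layers that the proof needs are obtained from a diagonal point \<open>(c, \<dots>, c)\<close> with
  \<open>c = \<plusminus>1\<close> by rotating the coordinates in \<open>S\<close> with a common angle and signed speeds
  \<open>e s \<in> {-1, 0, 1}\<close>, and the coordinates outside \<open>S\<close> freely.\<close>

definition flat :: "nat \<Rightarrow> complex \<Rightarrow> nat set \<Rightarrow> (nat \<Rightarrow> real) \<Rightarrow> (nat \<Rightarrow> complex) set" where
  "flat l c S e = {t\<in>torus l. \<exists>\<phi>. \<forall>s\<in>S. t s = c * cis (e s * \<phi>)}"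

definition diag_pt :: "nat \<Rightarrow> complex \<Rightarrow> nat \<Rightarrow> complex" where
  "diag_pt l c = (\<lambda>i. if i < l then c else 1)"

lemma diag_pt_in_torus: "c \<in> {1, -1} \<Longrightarrow> diag_pt l c \<in> torus l"
  unfolding torus_def diag_pt_def by auto

lemma flat_subset_torus: "flat l c S e \<subseteq> torus l"
  unfolding flat_def by blast

lemma flat_pointI:
  assumes "c \<in> {1, -1}" "S \<subseteq> {..<l}"
  shows "(\<lambda>i. if i < l then c * cis (if i \<in> S then e i * \<phi> else \<psi> i) else 1) \<in> flat l c S e"
  using assms unfolding flat_def torus_def by (auto simp: norm_mult intro!: exI[of _ \<phi>])

lemma diag_pt_in_flat:
  assumes "c \<in> {1, -1}" "S \<subseteq> {..<l}"
  shows "diag_pt l c \<in> flat l c S e"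
  using diag_pt_in_torus[OF assms(1)] assms(2)
  unfolding flat_def by (auto simp: diag_pt_def intro!: exI[of _ 0])

text \<open>Scaling all rotation angles by a parameter in \<open>[0, 1]\<close> joins the diagonal
  point to any point of the flat. On \<open>S\<close> this only rescales \<open>\<phi>\<close>, so
  the path stays in the flat.\<close>

lemma connected_flat:
  assumes c: "c \<in> {1, -1}" and S: "S \<subseteq> {..<l}"
  shows "connected (flat l c S e)"
proof -
  let ?p = "diag_pt l c"
  have "connected_component (flat l c S e) ?p t" if t: "t \<in> flat l c S e" for t
  proof -
    obtain \<phi> where \<phi>: "\<forall>s\<in>S. t s = c * cis (e s * \<phi>)" and tt: "t \<in> torus l"
      using t unfolding flat_def by blast
    define \<theta> where "\<theta> = (\<lambda>i. if i \<in> S then e i * \<phi> else if i < l then Arg (c * t i) else 0)"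
    \<comment> \<open>As \<open>c * c = 1\<close>, the number \<open>Arg (c * t i)\<close> is the
      angle that turns \<open>c\<close> into \<open>t i\<close>.\<close>
    have "c * t i = cis (Arg (c * t i))" if "i < l" for i
      using that c tt cis_Arg[of "c * t i"] torus_nonzero[OF tt, of i]
      unfolding torus_def by (auto simp: sgn_eq)
    then have "t i = c * cis (Arg (c * t i))" if "i < l" for i
      using that c by (metis insertE mult_1 mult_minus1 minus_minus singletonD)
    then have teq: "t = (\<lambda>i. ?p i * cis (\<theta> i))"
      using \<phi> S tt unfolding diag_pt_def \<theta>_def torus_def by fastforce
    have "(\<lambda>i. ?p i * cis (s * \<theta> i)) \<in> flat l c S e" for s
    proof -
      have "(\<lambda>i. ?p i * cis (s * \<theta> i)) = (\<lambda>i. if i < l then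
          c * cis (if i \<in> S then e i * (s * \<phi>) else s * \<theta> i) else 1)"
        using S by (auto simp: diag_pt_def \<theta>_def fun_eq_iff mult_ac)
      then show ?thesis using flat_pointI[OF c S, of e "s * \<phi>" "\<lambda>i. s * \<theta> i"] by simp
    qed
    then show ?thesis
      using connected_component_rotation[of ?p \<theta> "flat l c S e"] teq by simp
  qed
  then have "connected_component_set (flat l c S e) ?p = flat l c S e"
    using connected_component_subset[of "flat l c S e" ?p] by blast
  then show ?thesis using connected_connected_component by metis
qed

section \<open>Hypersurfaces containing a flat\<close>

lemma cis_quarter_turn:
  assumes "x \<in> {-1, 0, 1}"
  shows "cis (x * (pi / 2)) = (if x = 1 then \<i> else if x = 0 then 1 else - \<i>)"
  using assms by (auto simp: complex_eq_iff)

text \<open>Test points decide: zero angles give \<open>c = 1\<close>, a quarter turn of the free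
  coordinates puts \<open>a\<close> in \<open>S\<close>, and \<open>\<phi> = pi / 2\<close> rules
  out a nonzero speed.\<close>

lemma flat_subset_coord:
  assumes "c \<in> {1, -1}" "S \<subseteq> {..<l}" "e a \<in> {-1, 0, 1}" "a < l"
  shows "flat l c S e \<subseteq> {t\<in>torus l. t a = 1} \<longleftrightarrow> c = 1 \<and> a \<in> S \<and> e a = 0"
proof
  assume sub: "flat l c S e \<subseteq> {t\<in>torus l. t a = 1}"
  have *: "c * cis (if a \<in> S then e a * \<phi> else \<psi>) = 1" for \<phi> \<psi>
    using subsetD[OF sub flat_pointI[OF assms(1,2), of e \<phi> "\<lambda>_. \<psi>"]] assms(4) by auto
  have c: "c = 1" using *[of 0 0] by (simp split: if_splits)
  moreover have "a \<in> S" using *[of 0 "pi / 2"] c by (auto split: if_splits simp: complex_eq_iff)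
  moreover have "e a = 0"
    using *[of "pi / 2" 0] c \<open>a \<in> S\<close> cis_quarter_turn[OF assms(3)]
    by (auto split: if_splits simp: complex_eq_iff)
  ultimately show "c = 1 \<and> a \<in> S \<and> e a = 0" by blast
qed (auto simp: flat_def)

text \<open>The common factor \<open>c\<close> cancels. Turning one coordinate alone by a quarter
  shows that it cannot be free, and at \<open>\<phi> = pi / 2\<close> the speeds -1, 0, 1 give three
  distinct values.\<close>

lemma flat_subset_eq:
  assumes "c \<in> {1, -1}" "S \<subseteq> {..<l}" "e a \<in> {-1, 0, 1}" "e b \<in> {-1, 0, 1}"
    and "a < l" "b < l" "a \<noteq> b"
  shows "flat l c S e \<subseteq> {t\<in>torus l. t a = t b} \<longleftrightarrow> a \<in> S \<and> b \<in> S \<and> e a = e b"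
proof
  assume sub: "flat l c S e \<subseteq> {t\<in>torus l. t a = t b}"
  have *: "cis (if a \<in> S then e a * \<phi> else \<psi> a) = cis (if b \<in> S then e b * \<phi> else \<psi> b)" for \<phi> \<psi>
    using subsetD[OF sub flat_pointI[OF assms(1,2), of e \<phi> \<psi>]] assms(1,5,6) by auto
  have a: "a \<in> S"
    using *[of 0 "\<lambda>i. if i = a then pi / 2 else 0"] assms(7)
    by (auto split: if_splits simp: complex_eq_iff)
  have b: "b \<in> S"
    using *[of 0 "\<lambda>i. if i = b then pi / 2 else 0"] assms(7)
    by (auto split: if_splits simp: complex_eq_iff)
  have "e a = e b"
    using *[of "pi / 2" "\<lambda>_. 0"] a b cis_quarter_turn[OF assms(3)] cis_quarter_turn[OF assms(4)]
      assms(3,4)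
    by (auto split: if_splits simp: complex_eq_iff)
  with a b show "a \<in> S \<and> b \<in> S \<and> e a = e b" by blast
qed (auto simp: flat_def)

text \<open>Here \<open>c * c = 1\<close> removes \<open>c\<close>. Among \<open>- \<i>\<close>,
  \<open>1\<close>, \<open>\<i>\<close> a product is 1 exactly for opposite speeds, so
  \<open>\<phi> = pi / 2\<close> again compares the speeds.\<close>

lemma flat_subset_prod:
  assumes "c \<in> {1, -1}" "S \<subseteq> {..<l}" "e a \<in> {-1, 0, 1}" "e b \<in> {-1, 0, 1}"
    and "a < l" "b < l" "a \<noteq> b"
  shows "flat l c S e \<subseteq> {t\<in>torus l. t a * t b = 1} \<longleftrightarrow> a \<in> S \<and> b \<in> S \<and> e a = - e b"
proof
  assume sub: "flat l c S e \<subseteq> {t\<in>torus l. t a * t b = 1}"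
  have *: "cis (if a \<in> S then e a * \<phi> else \<psi> a) * cis (if b \<in> S then e b * \<phi> else \<psi> b) = 1"
    for \<phi> \<psi>
    using subsetD[OF sub flat_pointI[OF assms(1,2), of e \<phi> \<psi>]] assms(1,5,6) by auto
  have a: "a \<in> S"
    using *[of 0 "\<lambda>i. if i = a then pi / 2 else 0"] assms(7)
    by (auto split: if_splits simp: complex_eq_iff)
  have b: "b \<in> S"
    using *[of 0 "\<lambda>i. if i = b then pi / 2 else 0"] assms(7)
    by (auto split: if_splits simp: complex_eq_iff)
  have "e a = - e b"
    using *[of "pi / 2" "\<lambda>_. 0"] a b cis_quarter_turn[OF assms(3)] cis_quarter_turn[OF assms(4)]
      assms(3,4)
    by (auto split: if_splits simp: complex_eq_iff)
  with a b show "a \<in> S \<and> b \<in> S \<and> e a = - e b" by blast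
next
  assume "a \<in> S \<and> b \<in> S \<and> e a = - e b"
  moreover have "c * cis (- x) * (c * cis x) = 1" for x
  proof -
    have "c * cis (- x) * (c * cis x) = (c * c) * (cis (- x) * cis x)" by (simp only: mult_ac)
    then show ?thesis using assms(1) by (auto simp: cis_mult)
  qed
  ultimately show "flat l c S e \<subseteq> {t\<in>torus l. t a * t b = 1}"
    by (auto simp: flat_def)
qed

text \<open>The hypersurfaces containing the flat tie all moving coordinates to one of them. For
  \<open>c = -1\<close> no hypersurface is \<open>{t_a = -1}\<close>, so a coordinate of speed 0
  needs a partner \<open>b\<close> of speed 0: \<open>t_a = t_b\<close> and
  \<open>t_a t_b = 1\<close> make \<open>t_a\<close> equal to 1 or -1, and connectedness selects the
  sign.\<close>

lemma flat_in_layers: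
  assumes c: "c \<in> {1, -1}" and S: "S \<subseteq> {..<l}" and e: "\<And>i. e i \<in> {-1, 0, 1}"
    and zeros: "\<And>a. a \<in> S \<Longrightarrow> e a = 0 \<Longrightarrow> c = 1 \<or> (\<exists>b\<in>S. b \<noteq> a \<and> e b = 0)"
  shows "flat l c S e \<in> layers l (arrB l)"
proof (rule layersI[OF connected_flat[OF c S] diag_pt_in_flat[OF c S] flat_subset_torus])
  fix D t
  assume D: "connected D" "diag_pt l c \<in> D" "t \<in> D" "D \<subseteq> torus l"
    and H: "\<And>H. H \<in> arrB l \<Longrightarrow> flat l c S e \<subseteq> H \<Longrightarrow> D \<subseteq> H"
  have lt: "a < l" if "a \<in> S" for a using S that by blast
  have eqs: "u a = u b" if "a \<in> S" "b \<in> S" "e a = e b" "u \<in> D" for a b u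
  proof (cases "a = b")
    case False
    then have "D \<subseteq> {t\<in>torus l. t a = t b}"
      using that e c S lt
      by (intro H arrB_eq flat_subset_eq[THEN iffD2] conjI) blast+
    then show ?thesis using that by blast
  qed simp
  have prods: "u a * u b = 1" if "a \<in> S" "b \<in> S" "a \<noteq> b" "e a = - e b" "u \<in> D" for a b u
  proof -
    have "D \<subseteq> {t\<in>torus l. t a * t b = 1}"
      using that e c S lt
      by (intro H arrB_prod flat_subset_prod[THEN iffD2] conjI) blast+
    then show ?thesis using that by blast
  qed
  have zero: "t a = c" if a: "a \<in> S" "e a = 0" for a
    using zeros[OF a]
  proof
    assume "c = 1"
    then have "D \<subseteq> {t\<in>torus l. t a = 1}"
      using a e c S lt
      by (intro H arrB_coord flat_subset_coord[THEN iffD2] conjI) blast+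
    then show ?thesis using D(3) \<open>c = 1\<close> by blast
  next
    assume "\<exists>b\<in>S. b \<noteq> a \<and> e b = 0"
    then obtain b where b: "b \<in> S" "b \<noteq> a" "e b = 0" by blast
    have "u a \<in> {1, -1}" if "u \<in> D" for u
      using eqs[of a b u] prods[of a b u] a b that by (auto simp: square_eq_1_iff)
    then have "t a = diag_pt l c a"
      by (rule connected_discrete_coordinate[OF D(1-3)])
    then show ?thesis using lt[OF a(1)] by (simp add: diag_pt_def)
  qed
  have "\<exists>\<phi>. \<forall>s\<in>S. t s = c * cis (e s * \<phi>)"
  proof (cases "\<exists>j\<in>S. e j \<noteq> 0")
    case True
    then obtain j where j: "j \<in> S" "e j \<noteq> 0" by blast
    have "cmod (t j) = 1" "t j \<noteq> 0"
      using lt[OF j(1)] D(3,4) torus_nonzero unfolding torus_def by auto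
    then have tj: "cis (Arg (c * t j)) = c * t j"
      using c by (subst cis_Arg) (auto simp: sgn_eq norm_mult)
    \<comment> \<open>The parameter is \<open>e j * Arg (c * t j)\<close>: as \<open>e j\<close> is
      1 or -1, the product \<open>e s * e j\<close> is the speed of \<open>s\<close> relative to
      \<open>j\<close>.\<close>
    have "t s = c * cis (e s * (e j * Arg (c * t j)))" if s: "s \<in> S" for s
    proof -
      consider "e s = 0" | "e s = e j" "e s * e j = 1" | "e s = - e j" "e s * e j = -1" "s \<noteq> j"
        using e[of s] e[of j] j(2) by fastforce
      then show ?thesis
      proof cases
        case 1
        then show ?thesis using zero[OF s] by simp
      next
        case 2
        have "t s = t j" using eqs[OF s j(1) 2(1) D(3)] .
        also have "\<dots> = c * cis (e s * e j * Arg (c * t j))"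
          using 2(2) tj c by auto
        finally show ?thesis by (simp add: mult.assoc)
      next
        case 3
        have "t j * t s = 1" using prods[OF s j(1) 3(3,1) D(3)] by (simp add: mult.commute)
        then have "t s = inverse (t j)" by (simp add: inverse_unique)
        also have "\<dots> = c * inverse (c * t j)"
          using c by auto
        also have "\<dots> = c * cis (e s * e j * Arg (c * t j))"
          using 3(2) arg_cong[OF tj, of inverse] by simp
        finally show ?thesis by (simp add: mult.assoc)
      qed
    qed
    then show ?thesis by blast
  next
    case False
    then show ?thesis using zero by (auto intro!: exI[of _ 0])
  qed
  then show "t \<in> flat l c S e"
    using D(3,4) unfolding flat_def by blast
qed

section \<open>Hypersurfaces, the torus and diagonal points as layers\<close>

lemma arrB_subset_layers: "arrB l \<subseteq> layers l (arrB l)"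
proof
  fix H assume "H \<in> arrB l"
  then show "H \<in> layers l (arrB l)"
  proof (cases rule: arrB_cases)
    case (coord a)
    then have "H = flat l 1 {a} (\<lambda>_. 0)" by (auto simp: flat_def)
    then show ?thesis using coord by (simp add: flat_in_layers)
  next
    case (prod a b)
    have *: "\<exists>\<phi>. t a = cis \<phi> \<and> t b = cis (- \<phi>)" if "t \<in> torus l" "t a * t b = 1" for t
      using that by (intro exI[of _ "Arg (t a)"])
        (simp add: cis_Arg_torus inverse_unique flip: cis_inverse)
    have "H = flat l 1 {a, b} (\<lambda>i. if i = a then 1 else -1)"
      using prod * by (auto simp: flat_def cis_mult)
    then show ?thesis using prod by (auto intro!: flat_in_layers split: if_splits)
  next
    case (eq a b)
    have "\<exists>\<phi>. t b = cis \<phi>" if "t \<in> torus l" for t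
      using that by (metis cis_Arg_torus)
    then have "H = flat l 1 {a, b} (\<lambda>_. 1)"
      using eq by (auto simp: flat_def)
    then show ?thesis using eq by (auto intro!: flat_in_layers)
  qed
qed

lemma torus_in_layers: "torus l \<in> layers l (arrB l)"
proof -
  have "torus l = flat l 1 {} (\<lambda>_. 0)" by (auto simp: flat_def)
  then show ?thesis by (simp add: flat_in_layers)
qed

text \<open>This is the flat with all speeds 0. For \<open>c = -1\<close> every coordinate needs a
  second one of speed 0, whence \<open>l \<ge> 2\<close>.\<close>

lemma singleton_diag_pt_in_layers:
  assumes "c = 1 \<or> c = -1 \<and> l \<ge> 2"
  shows "{diag_pt l c} \<in> layers l (arrB l)"
proof -
  have c: "c \<in> {1, -1}" using assms by auto
  have "t = diag_pt l c" if "t \<in> flat l c {..<l} (\<lambda>_. 0)" for t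
    using that by (auto simp: flat_def torus_def diag_pt_def)
  then have eq: "{diag_pt l c} = flat l c {..<l} (\<lambda>_. 0)"
    using diag_pt_in_flat[OF c, of "{..<l}"] by auto
  have "\<exists>b\<in>{..<l}. b \<noteq> a" if "l \<ge> 2" for a
    using that by (intro bexI[of _ "if a = 0 then 1 else 0"]) auto
  then show ?thesis
    unfolding eq using c assms by (intro flat_in_layers) auto
qed

lemma diag_one_in_arrB:
  assumes "H \<in> arrB l"
  shows "diag_pt l 1 \<in> H"
  using assms diag_pt_in_torus[of 1 l] by (cases rule: arrB_cases) (auto simp: diag_pt_def)

section \<open>Rank at least three\<close>

text \<open>In the interval below \<open>{x}\<close>, \<open>discrete\<close> makes the join of
  \<open>w\<close> and \<open>z\<close> the top \<open>{x}\<close>, while \<open>noH\<close> makes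
  the meet of \<open>y\<close> and \<open>w\<close> the bottom \<open>torus l\<close>. The modular
  law would then read \<open>y = z\<close>.\<close>

lemma not_modular_below_point:
  assumes x: "{x} \<in> layers l (arrB l)"
    and yL: "y \<in> layers l (arrB l)" and wL: "w \<in> layers l (arrB l)" and zL: "z \<in> layers l (arrB l)"
    and "x \<in> y" "x \<in> w" "y \<subseteq> z" "y \<noteq> z"
    and noH: "\<And>H. H \<in> arrB l \<Longrightarrow> y \<subseteq> H \<Longrightarrow> w \<subseteq> H \<Longrightarrow> False"
    and discrete: "\<And>t i. t \<in> w \<Longrightarrow> t \<in> z \<Longrightarrow> t i \<in> {1, -1}"
  shows "\<not> modular_elt (below (layers l (arrB l)) layer_le {x}) layer_le y"
proof
  let ?L = "below (layers l (arrB l)) layer_le {x}"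
  assume mod: "modular_elt ?L layer_le y"
  have L: "d \<in> ?L \<longleftrightarrow> d \<in> layers l (arrB l) \<and> x \<in> d" for d
    unfolding below_def layer_le_def by blast
  have inL: "w \<in> ?L" "z \<in> ?L" "y \<in> ?L"
    using assms by (auto simp: L)
  have "d = {x}" if "d \<in> ?L" "d \<subseteq> w" "d \<subseteq> z" for d
  proof (rule connected_discrete_singleton)
    show "connected d" "x \<in> d" using that(1) L layersD(1) by blast+
    show "u i \<in> {1, -1}" if "u \<in> d" for u i
      using discrete[of u i] that \<open>d \<subseteq> w\<close> \<open>d \<subseteq> z\<close> by blast
  qed
  then have 1: "is_lub ?L layer_le w z {x}"
    using x assms(5-7) by (auto simp: is_lub_def L layer_le_def)
  have 2: "is_glb ?L layer_le y {x} y"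
    using inL(3) assms(5) by (auto simp: is_glb_def layer_le_def)
  \<comment> \<open>A common lower bound of \<open>y\<close> and \<open>w\<close> lies in no
    hypersurface, so it absorbs the whole torus.\<close>
  have "torus l \<subseteq> d" if "d \<in> ?L" "y \<subseteq> d" "w \<subseteq> d" for d
  proof (rule layers_absorb[of d l "arrB l" _ x])
    show "d \<in> layers l (arrB l)" "x \<in> d" using that(1) L by simp_all
    show "connected (torus l)" using layersD(1)[OF torus_in_layers] .
    show "x \<in> torus l" using layersD(3)[OF x] by simp
    show "torus l \<subseteq> H" if "H \<in> arrB l" "d \<subseteq> H" for H
      using noH[OF that(1)] that(2) \<open>y \<subseteq> d\<close> \<open>w \<subseteq> d\<close> by blast
  qed simp
  then have 3: "is_glb ?L layer_le y w (torus l)"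
    using torus_in_layers layersD(3)[OF x] layersD(3)[OF yL] layersD(3)[OF wL]
    by (auto simp: is_glb_def L layer_le_def)
  have 4: "is_lub ?L layer_le (torus l) z z"
    using inL layersD(3)[OF zL] by (auto simp: is_lub_def layer_le_def)
  have "layer_le z y" using assms(7) by (simp add: layer_le_def)
  then have "y = z"
    using mod[unfolded modular_elt_def, THEN conjunct2, rule_format, OF inL(1,2) _ 1 2 3 4] by simp
  with assms(8) show False ..
qed

text \<open>A layer through \<open>(1, ..., 1)\<close> that is not a point contains some
  \<open>t\<close> with \<open>t_i\<close> different from 1 and -1. The speeds record which
  coordinates of \<open>t\<close> equal \<open>t_i\<close> or its inverse; the resulting line
  satisfies every equation of the arrangement that \<open>t\<close> satisfies.\<close>

lemma line_in_layer:
  assumes "y \<in> layers l (arrB l)" "diag_pt l 1 \<in> y" "y \<noteq> {diag_pt l 1}"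
  obtains e where "\<And>i. e i \<in> {-1, 0, 1::real}" "\<exists>i<l. e i \<noteq> 0" "flat l 1 {..<l} e \<subseteq> y"
proof -
  obtain t i where t: "t \<in> y" "t i \<notin> {1, -1}"
    using connected_discrete_singleton[OF layersD(1)[OF assms(1)] assms(2)] assms(3) by blast
  have tt: "t \<in> torus l" using t layersD(3)[OF assms(1)] by blast
  then have i: "i < l"
    using t unfolding torus_def by (metis (mono_tags, lifting) insertI1 linorder_not_le mem_Collect_eq)
  \<comment> \<open>Separates the two nonzero speeds: no coordinate is both equal and inverse to
    \<open>t i\<close>.\<close>
  have sq: "t i * t i \<noteq> 1" using t(2) by (auto simp: square_eq_1_iff)
  define e where "e = (\<lambda>j. if t j = t i then 1 else if t j * t i = 1 then -1 else (0::real))"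
  have e: "e j \<in> {-1, 0, 1}" for j by (simp add: e_def)
  have "flat l 1 {..<l} e \<subseteq> y"
  proof (rule layers_absorb[OF assms(1) connected_flat assms(2) diag_pt_in_flat flat_subset_torus])
    fix H assume H: "H \<in> arrB l" "y \<subseteq> H"
    then have tH: "t \<in> H" using t by blast
    show "flat l 1 {..<l} e \<subseteq> H"
      using H(1)
    proof (cases rule: arrB_cases)
      case (coord a)
      then have "e a = 0" using tH t(2) by (auto simp: e_def)
      then show ?thesis using coord e flat_subset_coord[of 1 "{..<l}" l e a] by auto
    next
      case (prod a b)
      then have ab: "t a * t b = 1" using tH by simp
      have "t a * t i = 1 \<longleftrightarrow> t b = t i" "t b * t i = 1 \<longleftrightarrow> t a = t i"
        using ab by (metis mult.assoc mult.commute mult.right_neutral)+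
      then have "e a = - e b" using sq by (auto simp: e_def)
      then show ?thesis using prod e flat_subset_prod[of 1 "{..<l}" l e a b] by auto
    next
      case (eq a b)
      then have "e a = e b" using tH by (simp add: e_def)
      then show ?thesis using eq e flat_subset_eq[of 1 "{..<l}" l e a b] by auto
    qed
  qed auto
  moreover have "e i \<noteq> 0" by (simp add: e_def)
  ultimately show thesis using that e i by blast
qed

text \<open>Witnesses for \<open>not_modular_below_point\<close>: \<open>w\<close> is
  \<open>{t_i = 1, t_m = t_j ^ d}\<close>, and \<open>z\<close> is obtained from the line by freeing
  coordinate \<open>i\<close>. The third index \<open>m\<close> exists because
  \<open>l \<ge> 3\<close>.\<close>

lemma line_not_modular:
  assumes l: "l \<ge> 3" and e: "\<And>s. e s \<in> {-1, 0, 1}"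
    and i: "i < l" "e i \<noteq> 0" and j: "j < l" "e j \<noteq> 0" and ij: "i \<noteq> j"
  shows "\<not> modular_elt (below (layers l (arrB l)) layer_le {diag_pt l 1}) layer_le (flat l 1 {..<l} e)"
proof -
  have "card ({..<l} - {i, j}) \<ge> 1" using l by (simp add: card_Diff_subset i j ij)
  then obtain m where m: "m < l" "m \<noteq> i" "m \<noteq> j"
    by (metis Diff_iff One_nat_def card.empty equals0I insert_iff lessThan_iff not_one_le_zero)
  \<comment> \<open>The sign \<open>d\<close> makes the line violate the equation \<open>t_m = t_j ^ d\<close> that defines \<open>w\<close> below.\<close>
  define d where "d = (if e m = e j then -1 else (1::real))"
  have d: "d \<in> {1, -1}" "e m \<noteq> d * e j"
    using e[of j] j(2) by (auto simp: d_def)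
  define f where "f = (\<lambda>s. if s = j then 1 else if s = m then d else (0::real))"
  have f: "f s \<in> {-1, 0, 1}" for s using d(1) by (auto simp: f_def)
  define w where "w = flat l 1 {i, j, m} f"
  define z where "z = flat l 1 ({..<l} - {i}) e"
  let ?y = "flat l 1 {..<l} e"
  have sub: "{i, j, m} \<subseteq> {..<l}" using i j m by auto
  show ?thesis
  proof (rule not_modular_below_point[where w = w and z = z])
    show "{diag_pt l 1} \<in> layers l (arrB l)" by (rule singleton_diag_pt_in_layers) simp
    show "?y \<in> layers l (arrB l)" using e by (intro flat_in_layers) auto
    show "w \<in> layers l (arrB l)" unfolding w_def using f sub by (intro flat_in_layers) auto
    show "z \<in> layers l (arrB l)" unfolding z_def using e by (intro flat_in_layers) auto
    show "diag_pt l 1 \<in> ?y" by (rule diag_pt_in_flat) auto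
    show "diag_pt l 1 \<in> w" unfolding w_def using sub by (intro diag_pt_in_flat) auto
    show "?y \<subseteq> z" unfolding z_def flat_def by blast
    \<comment> \<open>Turning coordinate \<open>i\<close> by \<open>pi\<close> gives
      \<open>t_i = -1\<close> and \<open>t_j = 1\<close>, but on the line \<open>t_i\<close> is
      \<open>t_j\<close> or its inverse.\<close>
    have "(\<lambda>s. if s < l then 1 * cis (if s \<in> {..<l} - {i} then e s * 0 else pi) else 1) \<in> z" (is "?p \<in> z")
      unfolding z_def by (rule flat_pointI) auto
    moreover have "?p \<notin> ?y"
    proof
      assume "?p \<in> ?y"
      then obtain \<phi> where \<phi>: "\<forall>s<l. ?p s = cis (e s * \<phi>)" unfolding flat_def by auto
      have "cis (e j * \<phi>) = 1" "cis (e i * \<phi>) = -1"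
        using \<phi>[rule_format, of j] \<phi>[rule_format, of i] i j ij by auto
      moreover have "e j = e i \<or> e j = - e i" using e[of i] e[of j] i(2) j(2) by auto
      ultimately show False by (auto simp: complex_eq_iff)
    qed
    ultimately show "?y \<noteq> z" by blast
  next
    fix H assume "H \<in> arrB l" and yH: "?y \<subseteq> H" and wH: "w \<subseteq> H"
    then show False
    proof (cases rule: arrB_cases)
      case (coord a)
      have "e a = 0"
        using yH coord e flat_subset_coord[of 1 "{..<l}" l e a] by auto
      moreover have "a \<in> {i, j, m}" "f a = 0"
        using wH coord f sub flat_subset_coord[of 1 "{i, j, m}" l f a] unfolding w_def by auto
      then have "a = i" using d(1) m by (auto simp: f_def split: if_splits)
      ultimately show False using i by simp
    next
      case (prod a b)
      have ab: "e a = - e b"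
        using yH prod e flat_subset_prod[of 1 "{..<l}" l e a b] by auto
      have fab: "a \<in> {i, j, m}" "b \<in> {i, j, m}" "f a = - f b"
        using wH prod f sub flat_subset_prod[of 1 "{i, j, m}" l f a b] unfolding w_def by auto
      then show False
        using ab d m ij prod(3) by (auto simp: f_def split: if_splits)
    next
      case (eq a b)
      have ab: "e a = e b"
        using yH eq e flat_subset_eq[of 1 "{..<l}" l e a b] by auto
      have fab: "a \<in> {i, j, m}" "b \<in> {i, j, m}" "f a = f b"
        using wH eq f sub flat_subset_eq[of 1 "{i, j, m}" l f a b] unfolding w_def by auto
      then show False
        using ab d m ij eq(3) by (auto simp: f_def split: if_splits)
    qed
  next
    fix t s assume tw: "t \<in> w" and tz: "t \<in> z"
    obtain \<psi> where "\<forall>s\<in>{i, j, m}. t s = cis (f s * \<psi>)"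
      using tw unfolding w_def flat_def by auto
    then have \<psi>: "t i = 1" "t j = cis \<psi>" "t m = cis (d * \<psi>)"
      using m ij by (auto simp: f_def)
    obtain \<phi> where \<phi>: "\<forall>s\<in>{..<l} - {i}. t s = cis (e s * \<phi>)"
      using tz unfolding z_def flat_def by auto
    have tj: "cis \<psi> = cis (e j * \<phi>)" and tm: "cis (d * \<psi>) = cis (e m * \<phi>)"
      using \<phi> \<psi> m i j ij by auto
    have "cis (d * \<psi>) = cis (d * e j * \<phi>)"
      using d(1) tj by (auto simp flip: cis_inverse)
    then have eq: "cis (d * e j * \<phi>) = cis (e m * \<phi>)" using tm by simp
    have dj: "d * e j \<in> {-1, 1}" using d(1) e[of j] j(2) by auto
    \<comment> \<open>The two descriptions of \<open>t m\<close> have different speeds: either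
      \<open>e m = 0\<close>, so \<open>cis \<phi> = 1\<close>, or they are opposite, so
      \<open>cis \<phi>\<close> squares to 1.\<close>
    have "cis \<phi> \<in> {1, -1}"
    proof -
      consider "e m = 0" | "e m = - (d * e j)" using dj d(2) e[of m] by fastforce
      then show ?thesis
      proof cases
        case 1
        then show ?thesis using dj eq by (auto simp: complex_eq_iff)
      next
        case 2
        then have "cis \<phi> = cis (- \<phi>)" using dj eq by auto
        then have "cis \<phi> * cis \<phi> = 1" by (metis add.right_inverse cis_mult cis_zero)
        then show ?thesis by (auto simp: square_eq_1_iff)
      qed
    qed
    then have "cis (x * \<phi>) \<in> {1, -1}" if "x \<in> {-1, 0, 1}" for x
      using that by (auto simp: complex_eq_iff)
    then have "cis (e s * \<phi>) \<in> {1, -1}" using e by blast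
    moreover have "t s = 1" if "s \<ge> l" using that tw unfolding w_def flat_def torus_def by auto
    ultimately show "t s \<in> {1, -1}"
      using \<psi>(1) \<phi> by (cases "s < l"; cases "s = i") auto
  qed
qed

text \<open>Take \<open>w = {t_k = t_i = -1}\<close> and let \<open>z\<close> equate all coordinates
  other than the \<open>k\<close>-th. Hypersurfaces containing \<open>w\<close> involve both
  \<open>k\<close> and \<open>i\<close>, those containing \<open>y\<close> avoid \<open>k\<close>,
  so none is common. On \<open>w\<close> and \<open>z\<close> together, \<open>t_i = -1\<close>
  spreads to all coordinates.\<close>

lemma minus_line_not_modular:
  assumes l: "l \<ge> 3" and k: "k < l"
  defines "y \<equiv> flat l (-1) {..<l} (\<lambda>s. if s = k then 1 else 0)"
  shows "y \<in> layers l (arrB l)"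
    and "\<not> modular_elt (below (layers l (arrB l)) layer_le {diag_pt l (-1)}) layer_le y"
proof -
  let ?e = "\<lambda>s. if s = k then 1 else (0::real)"
  \<comment> \<open>With \<open>l \<ge> 3\<close> each \<open>a\<close> has a partner outside
    \<open>{a, k}\<close>, as \<open>flat_in_layers\<close> demands for coordinates of speed
    0.\<close>
  have others: "\<exists>b<l. b \<noteq> a \<and> b \<noteq> k" for a
  proof -
    have "card ({..<l} - {a, k}) \<ge> 1"
      using l card_insert_le_m1[of 2 "{k}" a] diff_card_le_card_Diff[of "{a, k}" "{..<l}"] by simp
    then show ?thesis
      by (metis Diff_iff One_nat_def card.empty equals0I insert_iff lessThan_iff not_one_le_zero)
  qed
  show yL: "y \<in> layers l (arrB l)"
    unfolding y_def using others by (intro flat_in_layers) (auto split: if_splits)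
  obtain i where i: "i < l" "i \<noteq> k" using others by blast
  define w where "w = flat l (-1) {k, i} (\<lambda>_. 0)"
  define z where "z = flat l (-1) ({..<l} - {k}) (\<lambda>_. 1)"
  have sub: "{k, i} \<subseteq> {..<l}" using i k by auto
  show "\<not> modular_elt (below (layers l (arrB l)) layer_le {diag_pt l (-1)}) layer_le y"
  proof (rule not_modular_below_point[where w = w and z = z])
    show "{diag_pt l (-1)} \<in> layers l (arrB l)"
      using l by (intro singleton_diag_pt_in_layers) simp
    show "y \<in> layers l (arrB l)" by (rule yL)
    show "w \<in> layers l (arrB l)" unfolding w_def using sub i by (intro flat_in_layers) auto
    show "z \<in> layers l (arrB l)" unfolding z_def by (intro flat_in_layers) auto
    show "diag_pt l (-1) \<in> y" unfolding y_def by (rule diag_pt_in_flat) auto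
    show "diag_pt l (-1) \<in> w" unfolding w_def using sub by (intro diag_pt_in_flat) auto
    show "y \<subseteq> z" unfolding y_def z_def flat_def by (auto intro!: exI[of _ 0])
    have "(\<lambda>s. if s < l then (-1) * cis (if s \<in> {..<l} - {k} then 1 * pi else 0) else 1) \<in> z" (is "?p \<in> z")
      unfolding z_def by (rule flat_pointI) auto
    moreover have "?p \<notin> y"
      unfolding y_def flat_def using i by (auto intro!: bexI[of _ i])
    ultimately show "y \<noteq> z" by blast
  next
    fix H assume "H \<in> arrB l" and yH: "y \<subseteq> H" and wH: "w \<subseteq> H"
    then show False
    proof (cases rule: arrB_cases)
      case (coord a)
      then show False using yH flat_subset_coord[of "-1" "{..<l}" l ?e a] unfolding y_def by auto
    next
      case (prod a b)
      have "?e a = - ?e b"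
        using yH prod flat_subset_prod[of "-1" "{..<l}" l ?e a b] unfolding y_def by auto
      moreover have "a \<in> {k, i}" "b \<in> {k, i}"
        using wH prod sub flat_subset_prod[of "-1" "{k, i}" l "\<lambda>_. 0" a b] unfolding w_def by auto
      ultimately show False using prod(3) by (auto split: if_splits)
    next
      case (eq a b)
      have "?e a = ?e b"
        using yH eq flat_subset_eq[of "-1" "{..<l}" l ?e a b] unfolding y_def by auto
      moreover have "a \<in> {k, i}" "b \<in> {k, i}"
        using wH eq sub flat_subset_eq[of "-1" "{k, i}" l "\<lambda>_. 0" a b] unfolding w_def by auto
      ultimately show False using eq(3) by (auto split: if_splits)
    qed
  next
    fix t s assume tw: "t \<in> w" and tz: "t \<in> z"
    have ti: "t k = -1" "t i = -1" using tw unfolding w_def flat_def by auto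
    obtain \<phi> where \<phi>: "\<forall>s\<in>{..<l} - {k}. t s = - cis \<phi>"
      using tz unfolding z_def flat_def by auto
    then have "cis \<phi> = 1" using i ti by auto
    moreover have "t s = 1" if "s \<ge> l" using that tw unfolding w_def flat_def torus_def by auto
    ultimately show "t s \<in> {1, -1}"
      using ti \<phi> by (cases "s < l"; cases "s = k") auto
  qed
qed

lemma not_supersolvable_arrB:
  assumes l: "l \<ge> 3"
  shows "\<not> supersolvable_toric l (arrB l)"
proof
  let ?P = "layers l (arrB l)"
  let ?o = "diag_pt l 1"
  assume "supersolvable_toric l (arrB l)"
  then obtain Qs :: "nat \<Rightarrow> (nat \<Rightarrow> complex) set set" and r where
    Q0: "Qs 0 = {x\<in>?P. \<forall>y\<in>?P. layer_le x y}" and Qr: "Qs r = ?P"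
    and step: "\<And>i. i < r \<Longrightarrow> Qs i \<subset> Qs (Suc i) \<and> M_ideal (Qs (Suc i)) layer_le (Qs i)"
    and rank: "\<And>i. i \<le> r \<Longrightarrow> set_rank ?P layer_le (Qs i) = i"
    unfolding supersolvable_toric_def supersolvable_poset_def by blast
  note fin = finite_layers_arrB[of l]
  note mono = prank_strict_mono[OF fin layer_le_order]
  have oP: "{?o} \<in> ?P" by (rule singleton_diag_pt_in_layers) simp
  have mP: "{diag_pt l (-1)} \<in> ?P" using l by (intro singleton_diag_pt_in_layers) simp
  have neq: "?o \<noteq> diag_pt l (-1)" using l by (auto simp: diag_pt_def fun_eq_iff intro!: exI[of _ 0])
  \<comment> \<open>Otherwise every layer would be a minimum, although two distinct points are
    layers. So \<open>Qs (r - 1)\<close> is a genuine predecessor of the last ideal.\<close>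
  have "r \<noteq> 0"
  proof
    assume "r = 0"
    then have "\<forall>x\<in>?P. \<forall>y\<in>?P. y \<subseteq> x" using Q0 Qr unfolding layer_le_def by blast
    then have "{diag_pt l (-1)} \<subseteq> {?o}" using oP mP by blast
    then show False using neq by simp
  qed
  define Q where "Q = Qs (r - 1)"
  have QP: "Q \<subset> ?P" and M: "M_ideal ?P layer_le Q"
    using step[of "r - 1"] \<open>r \<noteq> 0\<close> Qr unfolding Q_def by auto
  have rQ: "Max (prank ?P layer_le ` Q) = r - 1" and rP: "Max (prank ?P layer_le ` ?P) = r"
    using rank[of "r - 1"] rank[of r] Qr unfolding set_rank_def Q_def by auto
  have oi: "order_ideal ?P layer_le Q" and pr: "pure ?P layer_le Q"
    and jc: "join_closed ?P layer_le Q"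
    and mx: "\<forall>x\<in>maximal_elts ?P layer_le. \<exists>y\<in>maximal_elts Q layer_le.
      layer_le y x \<and> modular_elt (below ?P layer_le x) layer_le y"
    using M by (simp_all add: M_ideal_def)
  have ideal: "x \<in> Q" if "y \<in> Q" "x \<in> ?P" "y \<subseteq> x" for x y
    using that oi by (simp add: order_ideal_def layer_le_def)
  \<comment> \<open>All hypersurfaces pass through \<open>?o\<close>, so \<open>{?o} \<in> Q\<close>
    would put every hypersurface, and by join-closure every layer, into \<open>Q\<close>.\<close>
  have oQ: "{?o} \<notin> Q"
  proof
    assume "{?o} \<in> Q"
    then have "H \<in> Q" if "H \<in> arrB l" for H
      using ideal that arrB_subset_layers diag_one_in_arrB[OF that] by blast
    then have "?P \<subseteq> Q" using layer_in_join_closed[OF jc] by blast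
    then show False using QP by blast
  qed
  have modular: "\<exists>y\<in>maximal_elts Q layer_le. x \<in> y \<and> modular_elt (below ?P layer_le {x}) layer_le y"
    if "{x} \<in> ?P" for x
  proof -
    have "{x} \<in> maximal_elts ?P layer_le"
      using that layersD(2) unfolding maximal_elts_def layer_le_def by blast
    then obtain y where "y \<in> maximal_elts Q layer_le" "layer_le y {x}"
      "modular_elt (below ?P layer_le {x}) layer_le y"
      using mx by blast
    then show ?thesis by (auto simp: layer_le_def)
  qed
  obtain y where y: "y \<in> maximal_elts Q layer_le" "?o \<in> y"
    and ymod: "modular_elt (below ?P layer_le {?o}) layer_le y"
    using modular[OF oP] by blast
  have yQ: "y \<in> Q" and yP: "y \<in> ?P" using y QP unfolding maximal_elts_def by blast+
  \<comment> \<open>Some maximal element of \<open>Q\<close> attains the rank \<open>r - 1\<close>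
    of \<open>Q\<close>, and purity transfers this rank to \<open>y\<close>.\<close>
  have "prank ?P layer_le y = r - 1"
  proof -
    have finQ: "finite Q" using fin QP finite_subset by blast
    have "Max (prank ?P layer_le ` Q) \<in> prank ?P layer_le ` Q"
      using finQ yQ by (intro Max_in) auto
    then obtain q where q: "q \<in> Q" "prank ?P layer_le q = r - 1" using rQ by auto
    obtain m where m: "m \<in> maximal_elts Q layer_le" "layer_le q m"
      using exists_maximal_above[OF finQ layer_le_order q(1)] by blast
    then have mQ: "m \<in> Q" unfolding maximal_elts_def by blast
    have "prank ?P layer_le m \<le> r - 1"
      unfolding rQ[symmetric] using finQ mQ by (intro Max_ge) auto
    moreover have "prank ?P layer_le q \<le> prank ?P layer_le m"
      using mono[of q m] m(2) q(1) mQ psubset_imp_subset[OF QP] by (cases "q = m") (auto simp: subset_iff)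
    ultimately have "prank ?P layer_le m = r - 1" using q by simp
    then show ?thesis using pr m(1) y(1) unfolding pure_def by metis
  qed
  have "y \<noteq> {?o}" using yQ oQ by blast
  then obtain e where e: "\<And>i. e i \<in> {-1, 0, 1}" "\<exists>i<l. e i \<noteq> 0" and sub: "flat l 1 {..<l} e \<subseteq> y"
    using line_in_layer[OF yP y(2)] by blast
  obtain k where k: "k < l" "e k \<noteq> 0" using e by blast
  let ?L = "flat l 1 {..<l} e"
  have LP: "?L \<in> ?P" using e by (intro flat_in_layers) auto
  have oL: "?o \<in> ?L" by (rule diag_pt_in_flat) auto
  have "?L \<noteq> {?o}"
  proof
    assume "?L = {?o}"
    then have "?L \<subseteq> {t\<in>torus l. t k = 1}"
      using k diag_one_in_arrB[OF arrB_coord[OF k(1)]] by simp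
    then have "e k = 0" by (subst (asm) flat_subset_coord) (use e(1) k(1) in auto)
    then show False using k(2) by simp
  qed
  \<comment> \<open>Rank squeeze: \<open>?L\<close> lies strictly below \<open>{?o}\<close>, whose
    rank is at most \<open>r\<close>. Since \<open>y\<close> lies below \<open>?L\<close> and
    already has rank \<open>r - 1\<close>, the two coincide.\<close>
  then have "prank ?P layer_le ?L < prank ?P layer_le {?o}"
    using oL by (intro mono LP oP) (auto simp: layer_le_def)
  also have "\<dots> \<le> r"
    unfolding rP[symmetric] using fin oP by (intro Max_ge) auto
  finally have yL: "y = ?L"
    using mono[OF yP LP] sub \<open>prank ?P layer_le y = r - 1\<close> unfolding layer_le_def by fastforce
  have e0: "e s = 0" if "s < l" "s \<noteq> k" for s
    using line_not_modular[of l e s k] l e(1) that k ymod yL by blast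
  \<comment> \<open>On the coordinate line \<open>?L\<close>, a hypersurface not containing it
    forces \<open>t_k = 1\<close>. Then \<open>{?o}\<close> is a minimal upper bound of
    \<open>H\<close> and \<open>?L\<close>, which contradicts \<open>oQ\<close>.\<close>
  have k_free: "?L \<subseteq> H" if H: "H \<in> arrB l" "H \<in> Q" for H
  proof (rule ccontr)
    assume nsub: "\<not> ?L \<subseteq> H"
    have "t = ?o" if t: "t \<in> ?L" "t \<in> H" for t
    proof -
      have ts: "t s = 1" if "s \<noteq> k" for s
        using t that e0[of s] unfolding flat_def torus_def by (cases "s < l") auto
      have "t k = 1"
        using H(1)
      proof (cases rule: arrB_cases)
        case (coord a)
        then have "\<not> e a = 0" using nsub flat_subset_coord[of 1 "{..<l}" l e a] e(1) by auto
        then show ?thesis using coord e0 t by auto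
      next
        case (prod a b)
        then have "e a \<noteq> - e b" using nsub flat_subset_prod[of 1 "{..<l}" l e a b] e(1) by auto
        then have "a = k \<or> b = k" using prod e0 by fastforce
        then show ?thesis using prod ts[of a] ts[of b] t by auto
      next
        case (eq a b)
        then have "e a \<noteq> e b" using nsub flat_subset_eq[of 1 "{..<l}" l e a b] e(1) by auto
        then have "a = k \<or> b = k" using eq e0 by fastforce
        then show ?thesis using eq ts[of a] ts[of b] t by auto
      qed
      then have "t s = 1" for s using ts by (cases "s = k") auto
      then show ?thesis by (simp add: fun_eq_iff diag_pt_def)
    qed
    then have "d = {?o}" if "d \<subseteq> H" "d \<subseteq> ?L" "?o \<in> d" for d
      using that by blast
    then have "{?o} \<in> mub ?P layer_le {H, ?L}"
      using oP oL diag_one_in_arrB[OF H(1)] by (simp add: mub_def layer_le_def)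
    moreover have "{H, ?L} \<subseteq> Q" using H yQ yL by simp
    ultimately show False using jc[unfolded join_closed_def, rule_format] oQ by blast
  qed
  define N where "N = flat l (-1) {..<l} (\<lambda>s. if s = k then 1 else 0)"
  note N = minus_line_not_modular[OF l k(1), folded N_def]
  \<comment> \<open>Either containment means that \<open>H\<close> does not involve coordinate
    \<open>k\<close>; the hypertori \<open>t_a = 1\<close> miss the point
    \<open>(-1, ..., -1)\<close>.\<close>
  have L_iff_N: "?L \<subseteq> H \<longleftrightarrow> N \<subseteq> H" if H: "H \<in> arrB l" "diag_pt l (-1) \<in> H" for H
    using H(1)
  proof (cases rule: arrB_cases)
    case (coord a)
    then show ?thesis using H(2) by (simp add: diag_pt_def)
  next
    case (prod a b)
    have "e a = - e b \<longleftrightarrow> a \<noteq> k \<and> b \<noteq> k"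
      using prod e0[of a] e0[of b] k(2) by auto
    moreover have "?L \<subseteq> H \<longleftrightarrow> e a = - e b"
      using flat_subset_prod[of 1 "{..<l}" l e a b] e(1)[of a] e(1)[of b] prod by simp
    moreover have "N \<subseteq> H \<longleftrightarrow> a \<noteq> k \<and> b \<noteq> k"
      using flat_subset_prod[of "-1" "{..<l}" l "\<lambda>s. if s = k then 1 else 0" a b] prod
      unfolding N_def by auto
    ultimately show ?thesis by simp
  next
    case (eq a b)
    have "e a = e b \<longleftrightarrow> a \<noteq> k \<and> b \<noteq> k"
      using eq e0[of a] e0[of b] k(2) by auto
    moreover have "?L \<subseteq> H \<longleftrightarrow> e a = e b"
      using flat_subset_eq[of 1 "{..<l}" l e a b] e(1)[of a] e(1)[of b] eq by simp
    moreover have "N \<subseteq> H \<longleftrightarrow> a \<noteq> k \<and> b \<noteq> k"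
      using flat_subset_eq[of "-1" "{..<l}" l "\<lambda>s. if s = k then 1 else 0" a b] eq
      unfolding N_def by auto
    ultimately show ?thesis by simp
  qed
  have mN: "diag_pt l (-1) \<in> N" unfolding N_def by (rule diag_pt_in_flat) auto
  \<comment> \<open>Hypersurfaces containing \<open>N\<close> contain \<open>?L = y\<close>, so they
    lie in the order ideal, and join-closure supplies \<open>N\<close>.\<close>
  have NQ: "N \<in> Q"
  proof (rule layer_in_join_closed[OF jc N(1)])
    fix H assume H: "H \<in> arrB l" "N \<subseteq> H"
    then have "?L \<subseteq> H" using L_iff_N mN by blast
    then show "H \<in> Q" using ideal[of ?L H] yQ yL H(1) arrB_subset_layers by blast
  qed
  obtain y' where y': "y' \<in> maximal_elts Q layer_le" "diag_pt l (-1) \<in> y'"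
    and y'mod: "modular_elt (below ?P layer_le {diag_pt l (-1)}) layer_le y'"
    using modular[OF mP] by blast
  have y'Q: "y' \<in> Q" using y' unfolding maximal_elts_def by blast
  \<comment> \<open>Hypersurfaces containing \<open>y'\<close> lie in \<open>Q\<close>, so they
    contain \<open>?L\<close> and hence \<open>N\<close>. Maximality of \<open>y'\<close> in
    \<open>Q\<close> then turns the inclusion into equality.\<close>
  have "N \<subseteq> y'"
  proof (rule layers_absorb[OF _ layersD(1)[OF N(1)] y'(2) mN layersD(3)[OF N(1)]])
    show "y' \<in> ?P" using y'Q QP by blast
    fix H assume H: "H \<in> arrB l" "y' \<subseteq> H"
    then have "H \<in> Q" using ideal[OF y'Q] arrB_subset_layers by blast
    then show "N \<subseteq> H" using k_free[OF H(1)] L_iff_N[OF H(1)] H(2) y'(2) by blast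
  qed
  then have "y' = N" using y'(1) NQ unfolding maximal_elts_def layer_le_def by blast
  then show False using y'mod N(2) by blast
qed

section \<open>Rank at most two\<close>

lemma bottom_layers: "{x\<in>layers l (arrB l). \<forall>y\<in>layers l (arrB l). layer_le x y} = {torus l}"
proof -
  have "x = torus l" if "x \<in> layers l (arrB l)" "\<forall>y\<in>layers l (arrB l). y \<subseteq> x" for x
    using that(2) torus_in_layers[of l] layersD(3)[OF that(1)] by (meson subset_antisym)
  then show ?thesis
    using torus_in_layers[of l] by (auto simp: layer_le_def dest: layersD(3))
qed

lemma layer_eq_torus:
  assumes "C \<in> layers l A" "\<And>H. H \<in> A \<Longrightarrow> \<not> C \<subseteq> H" "connected (torus l)"
  shows "C = torus l"
proof -
  obtain x where "x \<in> C" using layersD(2)[OF assms(1)] by blast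
  then have "torus l \<subseteq> C"
    using assms layersD(3)[OF assms(1)] by (intro layers_absorb[OF assms(1), of _ x]) auto
  then show ?thesis using layersD(3)[OF assms(1)] by blast
qed

lemma layer_eq_hypersurface:
  assumes "C \<in> layers l (arrB l)" "H \<in> arrB l" "C \<subseteq> H" "\<And>H'. H' \<in> arrB l \<Longrightarrow> C \<subseteq> H' \<Longrightarrow> H' = H"
  shows "C = H"
proof -
  have H: "H \<in> layers l (arrB l)" using assms(2) arrB_subset_layers by blast
  obtain x where x: "x \<in> C" using layersD(2)[OF assms(1)] by blast
  have "H \<subseteq> C"
  proof (rule layers_absorb[OF assms(1) layersD(1)[OF H] x _ layersD(3)[OF H]])
    show "x \<in> H" using x assms(3) by blast
    show "H \<subseteq> H'" if "H' \<in> arrB l" "C \<subseteq> H'" for H'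
      using assms(4)[OF that] by simp
  qed
  then show ?thesis using assms(3) by blast
qed

section \<open>Dimension one: a two-element chain\<close>

lemma supersolvable_arrB_1: "supersolvable_toric 1 (arrB 1)"
proof -
  let ?P = "layers 1 (arrB 1)"
  let ?o = "diag_pt 1 1"
  have oP: "{?o} \<in> ?P" by (rule singleton_diag_pt_in_layers) simp
  have "t = ?o" if "t \<in> torus 1" "t 0 = 1" for t
  proof -
    have "t i = 1" for i using that by (cases "i = 0") (auto simp: torus_def)
    then show ?thesis by (simp add: diag_pt_def fun_eq_iff)
  qed
  moreover have "?o \<in> torus 1" "?o 0 = 1"
    using diag_pt_in_torus[of 1 1] by (simp_all add: diag_pt_def)
  ultimately have "{t\<in>torus 1. t 0 = 1} = {?o}" by blast
  note coord1 = this
  have "H = {?o}" if "H \<in> arrB 1" for H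
    using that by (cases rule: arrB_cases) (auto simp: coord1 simp del: One_nat_def)
  then have P: "C = torus 1 \<or> C = {?o}" if "C \<in> ?P" for C
    using layer_eq_torus[OF that _ layersD(1)[OF torus_in_layers]] layersD(2)[OF that] by blast
  have "diag_pt 1 (-1) \<in> torus 1" by (rule diag_pt_in_torus) simp
  moreover have "diag_pt 1 (-1) \<noteq> ?o"
    by (auto simp: diag_pt_def fun_eq_iff intro!: exI[of _ 0])
  ultimately have neq: "torus 1 \<noteq> {?o}" by blast
  have oT: "{?o} \<subseteq> torus 1" using layersD(3)[OF oP] .
  note fin = finite_layers_arrB[of 1]
  define f where "f = (\<lambda>C. if C = torus 1 then 0 else (1::nat))"
  have f: "f u < f v" if "u \<in> ?P" "v \<in> ?P" "layer_le u v" "u \<noteq> v" for u v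
    using P[OF that(1)] P[OF that(2)] that(3,4) neq oT by (auto simp: f_def layer_le_def)
  have rank_le: "prank ?P layer_le C \<le> f C" if "C \<in> ?P" for C
    using that by (intro prank_le_height[OF fin f])
  have r0: "prank ?P layer_le (torus 1) = 0"
    using rank_le[OF torus_in_layers] by (simp add: f_def)
  have "prank ?P layer_le (torus 1) < prank ?P layer_le {?o}"
    using neq oT by (intro prank_strict_mono[OF fin layer_le_order torus_in_layers oP])
      (auto simp: layer_le_def)
  moreover have le1: "prank ?P layer_le C \<le> 1" if "C \<in> ?P" for C
    using rank_le[OF that] by (simp add: f_def split: if_splits)
  ultimately have r1: "prank ?P layer_le {?o} = 1"
    using le1[OF oP] by linarith
  have rank: "set_rank ?P layer_le ?P = 1"
    unfolding set_rank_def using fin le1 oP r1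
    by (intro Max_eqI) (auto intro: image_eqI[of _ _ "{?o}"])
  have rank0: "set_rank ?P layer_le {torus 1} = 0"
    unfolding set_rank_def using r0 by simp
  have M: "M_ideal ?P layer_le {torus 1}"
    using layersD(3)
    by (intro M_ideal_bottom layer_le_order torus_in_layers) (simp add: layer_le_def)
  have sub: "{torus 1} \<subset> ?P" using torus_in_layers oP neq by blast
  define Qs where "Qs = (\<lambda>i::nat. if i = 0 then {torus 1} else ?P)"
  show ?thesis
    unfolding supersolvable_toric_def supersolvable_poset_def bottom_layers
    by (intro exI[of _ Qs] exI[of _ 1])
      (use M sub rank rank0 in \<open>simp add: Qs_def le_Suc_eq all_conj_distrib\<close>)
qed

section \<open>Dimension two: four curves on a torus\<close>

lemma arrB_2_cases:
  assumes "H \<in> arrB 2"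
  shows "H = {t\<in>torus 2. t 0 = 1} \<or> H = {t\<in>torus 2. t 1 = 1} \<or>
    H = {t\<in>torus 2. t 0 * t 1 = 1} \<or> H = {t\<in>torus 2. t 0 = t 1}"
  using assms
proof (cases rule: arrB_cases)
  case (coord a)
  then show ?thesis by (auto simp: less_2_cases_iff)
next
  case (prod a b)
  then have "a = 0 \<and> b = 1 \<or> a = 1 \<and> b = 0" by (auto simp: less_2_cases_iff)
  then show ?thesis using prod by (auto simp: mult.commute)
next
  case (eq a b)
  then have "a = 0 \<and> b = 1 \<or> a = 1 \<and> b = 0" by (auto simp: less_2_cases_iff)
  moreover have "{t\<in>torus 2. t 1 = t 0} = {t\<in>torus 2. t 0 = t 1}" by auto
  ultimately show ?thesis using eq by auto
qed

text \<open>Solving each pair of the four equations leaves only \<open>(1, 1)\<close> and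
  \<open>(-1, -1)\<close>. That all crossings lie on the diagonal is what makes the diagonal
  suitable for an M-ideal.\<close>

lemma arrB_2_inter:
  assumes "H \<in> arrB 2" "H' \<in> arrB 2" "H \<noteq> H'" "t \<in> H" "t \<in> H'"
  shows "t 0 = t 1" "t i \<in> {1, -1}"
proof -
  have *: "t 0 = t 1 \<and> t 0 \<in> {1, -1}"
    using arrB_2_cases[OF assms(1)] arrB_2_cases[OF assms(2)] assms(3-5)
    by (elim disjE) (auto simp: square_eq_1_iff)
  then show "t 0 = t 1" by blast
  have "t \<in> torus 2" using assms(1,4) arrB_subset_layers layersD(3) by blast
  then have "t i = 1" if "i \<ge> 2" using that unfolding torus_def by blast
  moreover have "i = 0 \<or> i = 1 \<or> i \<ge> 2" by linarith
  ultimately show "t i \<in> {1, -1}"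
    using * by auto
qed

text \<open>A proper inclusion would make \<open>H\<close> an intersection of two distinct curves
  and so confine its coordinates to 1 and -1.\<close>

lemma arrB_2_antichain:
  assumes H: "H \<in> arrB 2" and H': "H' \<in> arrB 2" and "H \<subseteq> H'"
  shows "H = H'"
proof (rule ccontr)
  assume "H \<noteq> H'"
  then have discrete: "t i \<in> {1, -1}" if "t \<in> H" for t i
    using arrB_2_inter(2)[OF H H'] that assms(3) by blast
  define p where "p = (\<lambda>(a::complex) b (i::nat). if i = 0 then a else if i = 1 then b else 1)"
  have "p a b \<in> torus 2" if "cmod a = 1" "cmod b = 1" for a b
    using that unfolding torus_def p_def by auto
  then have pt: "p 1 \<i> \<in> torus 2" "p \<i> 1 \<in> torus 2" "p \<i> (- \<i>) \<in> torus 2" "p \<i> \<i> \<in> torus 2"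
    by simp_all
  have v: "p a b 0 = a" "p a b 1 = b" for a b by (simp_all add: p_def)
  \<comment> \<open>One point with a coordinate \<open>\<i>\<close> for each of the four curves, in
    the order of \<open>arrB_2_cases\<close>.\<close>
  have "p 1 \<i> \<in> H \<or> p \<i> 1 \<in> H \<or> p \<i> (- \<i>) \<in> H \<or> p \<i> \<i> \<in> H"
    using arrB_2_cases[OF H] pt by (elim disjE) (simp_all add: p_def)
  then have "\<i> \<in> {1, -1}"
    using discrete[of "p 1 \<i>" 1] discrete[of "p \<i> 1" 0] discrete[of "p \<i> (- \<i>)" 0] discrete[of "p \<i> \<i>" 0]
    unfolding v by blast
  then show False by (auto simp: complex_eq_iff)
qed

text \<open>The three cases correspond to \<open>C\<close> lying in no, exactly one, or at least two
  hypersurfaces.\<close>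

lemma layers_2_cases:
  assumes "C \<in> layers 2 (arrB 2)"
  shows "C = torus 2 \<or> C \<in> arrB 2 \<or> (\<exists>p. C = {p} \<and> p 0 = p 1)"
proof (cases "\<exists>H\<in>arrB 2. \<exists>H'\<in>arrB 2. H \<noteq> H' \<and> C \<subseteq> H \<and> C \<subseteq> H'")
  case True
  then obtain H H' where H: "H \<in> arrB 2" "H' \<in> arrB 2" "H \<noteq> H'" "C \<subseteq> H" "C \<subseteq> H'" by blast
  obtain p where p: "p \<in> C" using layersD(2)[OF assms] by blast
  have "C = {p}"
    using arrB_2_inter(2)[OF H(1-3)] H(4,5)
    by (intro connected_discrete_singleton[OF layersD(1)[OF assms] p]) blast
  moreover have "p 0 = p 1" using arrB_2_inter(1)[OF H(1-3)] H(4,5) p by blast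
  ultimately show ?thesis by blast
next
  case False
  then show ?thesis
    using layer_eq_torus[OF assms _ layersD(1)[OF torus_in_layers]] layer_eq_hypersurface[OF assms]
    by metis
qed

lemma supersolvable_arrB_2: "supersolvable_toric 2 (arrB 2)"
proof -
  let ?P = "layers 2 (arrB 2)"
  let ?o = "diag_pt 2 1"
  let ?T = "torus 2"
  define D where "D = {t\<in>torus 2. t 0 = t 1}"
  have DA: "D \<in> arrB 2" unfolding D_def by (rule arrB_eq) auto
  have DP: "D \<in> ?P" using DA arrB_subset_layers by blast
  have TP: "?T \<in> ?P" by (rule torus_in_layers)
  have oP: "{?o} \<in> ?P" by (rule singleton_diag_pt_in_layers) simp
  have sub_T: "C \<subseteq> ?T" if "C \<in> ?P" for C using layersD(3)[OF that] .
  have oD: "{?o} \<subseteq> D" using diag_one_in_arrB[OF DA] by blast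
  have neg: "diag_pt 2 (-1) \<in> D"
    using diag_pt_in_torus[of "-1" 2] unfolding D_def by (simp add: diag_pt_def)
  moreover have "diag_pt 2 (-1) \<noteq> ?o"
    by (auto simp: diag_pt_def fun_eq_iff intro!: exI[of _ 0])
  ultimately have neq1: "D \<noteq> {?o}" by blast
  have "?T \<notin> arrB 2"
  proof
    assume "?T \<in> arrB 2"
    then have "{t\<in>torus 2. t 0 = 1} = ?T"
      by (intro arrB_2_antichain arrB_coord) auto
    moreover have "diag_pt 2 (-1) \<in> ?T" "diag_pt 2 (-1) 0 \<noteq> 1"
      using diag_pt_in_torus[of "-1" 2] by (simp_all add: diag_pt_def)
    ultimately show False by blast
  qed
  then have neq0: "D \<noteq> ?T" using DA by blast
  have above_D: "z = D \<or> z = ?T" if "z \<in> ?P" "D \<subseteq> z" for z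
    using layers_2_cases[OF that(1)] arrB_2_antichain[OF DA] that layersD(2)[OF DP] by blast
  note fin = finite_layers_arrB[of 2]
  define f where "f = (\<lambda>C. if C = ?T then 0 else if C \<in> arrB 2 then 1 else (2::nat))"
  have f: "f u < f v" if "u \<in> ?P" "v \<in> ?P" "layer_le u v" "u \<noteq> v" for u v
  proof -
    have vu: "v \<subseteq> u" using that(3) by (simp add: layer_le_def)
    have vT: "v \<noteq> ?T" using vu sub_T[OF that(1)] that(4) by blast
    have "u = ?T \<or> u \<in> arrB 2"
      using layers_2_cases[OF that(1)] vu that(4) layersD(2)[OF that(2)] by blast
    moreover have "u = ?T" if "v \<in> arrB 2"
      using calculation arrB_2_antichain[OF that _ vu] \<open>u \<noteq> v\<close> by blast
    ultimately show ?thesis using vT by (auto simp: f_def)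
  qed
  have rank_le: "prank ?P layer_le C \<le> f C" if "C \<in> ?P" for C
    using that by (intro prank_le_height[OF fin f])
  note mono = prank_strict_mono[OF fin layer_le_order]
  have r0: "prank ?P layer_le ?T = 0"
    using rank_le[OF TP] by (simp add: f_def)
  have TD: "prank ?P layer_le ?T < prank ?P layer_le D"
    using neq0 sub_T[OF DP] by (intro mono TP DP) (auto simp: layer_le_def)
  have Do: "prank ?P layer_le D < prank ?P layer_le {?o}"
    using neq1 oD by (intro mono oP DP) (auto simp: layer_le_def)
  have le2: "prank ?P layer_le C \<le> 2" if "C \<in> ?P" for C
    using rank_le[OF that] by (simp add: f_def split: if_splits)
  \<comment> \<open>Two strict increases from rank 0 to a rank of at most 2 leave no other
    values.\<close>
  have r1: "prank ?P layer_le D = 1" and r2: "prank ?P layer_le {?o} = 2"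
    using TD Do le2[OF oP] by linarith+
  have rank2: "set_rank ?P layer_le ?P = 2"
    unfolding set_rank_def using fin le2 oP r2
    by (intro Max_eqI) (auto intro: image_eqI[of _ _ "{?o}"])
  have rank1: "set_rank ?P layer_le {?T, D} = 1"
    unfolding set_rank_def using r0 r1 by simp
  have rank0: "set_rank ?P layer_le {?T} = 0"
    unfolding set_rank_def using r0 by simp
  have M1: "M_ideal {?T, D} layer_le {?T}"
    using sub_T[OF DP] by (intro M_ideal_bottom layer_le_order) (auto simp: layer_le_def)
  have M2: "M_ideal ?P layer_le {?T, D}"
    unfolding M_ideal_def
  proof (intro conjI ballI impI)
    show "order_ideal ?P layer_le {?T, D}"
      using TP DP above_D sub_T unfolding order_ideal_def layer_le_def by blast
    have "x = D" if "x \<in> maximal_elts {?T, D} layer_le" for x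
      using that sub_T[OF DP] unfolding maximal_elts_def layer_le_def by blast
    then show "pure ?P layer_le {?T, D}"
      unfolding pure_def by metis
    show "join_closed ?P layer_le {?T, D}"
      unfolding join_closed_def
    proof (intro allI impI subsetI)
      fix S y assume S: "S \<subseteq> {?T, D}" and "y \<in> mub ?P layer_le S"
      then have y: "y \<in> ?P" "\<forall>s\<in>S. y \<subseteq> s"
        and min: "\<And>y'. y' \<in> ?P \<Longrightarrow> \<forall>s\<in>S. y' \<subseteq> s \<Longrightarrow> y \<subseteq> y' \<Longrightarrow> y' = y"
        by (simp_all add: mub_def layer_le_def)
      \<comment> \<open>Depending on whether \<open>D \<in> S\<close>, either \<open>D\<close> or
        \<open>?T\<close> is itself an upper bound of \<open>S\<close> lying below \<open>y\<close>,
        so minimality identifies it with \<open>y\<close>.\<close>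
      show "y \<in> {?T, D}"
      proof (cases "D \<in> S")
        case True
        then have "D = y" using S y sub_T[OF DP] by (intro min DP) auto
        then show ?thesis by simp
      next
        case False
        then have "?T = y" using S sub_T[OF y(1)] by (intro min TP) auto
        then show ?thesis by simp
      qed
    qed
  next
    fix a y assume "a \<in> atoms ?P layer_le" and a: "a \<notin> {?T, D}" and y: "y \<in> {?T, D}"
    then have aP: "a \<in> ?P" unfolding atoms_def by blast
    have self: "a \<in> mub ?P layer_le {a, y}" if "a \<subseteq> y"
      using aP that unfolding mub_def layer_le_def by blast
    show "mub ?P layer_le {a, y} \<noteq> {}"
    proof (cases "a \<subseteq> y")
      case True
      then show ?thesis using self by blast
    next
      case False
      then have yD: "y = D" using y sub_T[OF aP] by blast
      have aA: "a \<in> arrB 2"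
        using layers_2_cases[OF aP] a False yD sub_T[OF aP] unfolding D_def by blast
      \<comment> \<open>Two distinct curves share only points with entries 1 or -1, so a connected
        layer through \<open>?o\<close> inside both is \<open>{?o}\<close>.\<close>
      have min: "d = {?o}" if "d \<in> ?P" "d \<subseteq> a" "d \<subseteq> D" "?o \<in> d" for d
        using arrB_2_inter(2)[OF aA DA] a that
        by (intro connected_discrete_singleton[OF layersD(1)[OF that(1)]]) blast+
      have "{?o} \<in> mub ?P layer_le {a, y}"
        unfolding mub_def layer_le_def yD
      proof (intro CollectI conjI ballI impI)
        show "{?o} \<subseteq> t" if "t \<in> {a, D}" for t
          using that oD diag_one_in_arrB[OF aA] by blast
        show "d = {?o}" if "d \<in> ?P" "(\<forall>t\<in>{a, D}. d \<subseteq> t) \<and> {?o} \<subseteq> d" for d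
          using that by (intro min) simp_all
      qed (rule oP)
      then show ?thesis by blast
    qed
  next
    fix x assume "x \<in> maximal_elts ?P layer_le"
    then have xP: "x \<in> ?P" and max: "\<And>y. y \<in> ?P \<Longrightarrow> y \<subseteq> x \<Longrightarrow> y = x"
      by (auto simp: maximal_elts_def layer_le_def)
    have xD: "x \<subseteq> D"
    proof (cases "?o \<in> x")
      case True
      then have "{?o} = x" by (intro max oP) simp
      then show ?thesis using oD by simp
    next
      case False
      \<comment> \<open>The torus and all four curves contain \<open>?o\<close>, so a layer that
        misses it is a point with \<open>t_0 = t_1\<close>.\<close>
      then have "\<exists>p. x = {p} \<and> p 0 = p 1"
        using layers_2_cases[OF xP] diag_one_in_arrB sub_T[OF oP] by blast
      then show ?thesis using sub_T[OF xP] unfolding D_def by blast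
    qed
    \<comment> \<open>\<open>D\<close> is an atom: only itself and the bottom \<open>?T\<close> lie
      below it.\<close>
    have "modular_elt (below ?P layer_le x) layer_le D"
      by (rule modular_elt_if_atom_or_bottom[OF layer_le_order(1,3), where b = ?T])
        (use DP TP xD above_D sub_T sub_T[OF xP] in \<open>auto simp: below_def layer_le_def\<close>)
    moreover have "D \<in> maximal_elts {?T, D} layer_le"
      using neq0 sub_T[OF DP] by (auto simp: maximal_elts_def layer_le_def)
    ultimately show "\<exists>y\<in>maximal_elts {?T, D} layer_le.
        layer_le y x \<and> modular_elt (below ?P layer_le x) layer_le y"
      using xD by (auto simp: layer_le_def)
  qed
  have sub1: "{?T} \<subset> {?T, D}" using neq0 by blast
  have "{?o} \<notin> {?T, D}" using neq1 neq0 sub_T[OF DP] oD by blast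
  then have "{?T, D} \<noteq> ?P" using oP by metis
  then have sub2: "{?T, D} \<subset> ?P" using TP DP by (intro psubsetI) simp_all
  define Qs where "Qs = (\<lambda>i::nat. if i = 0 then {?T} else if i = 1 then {?T, D} else ?P)"
  have Q: "Qs 0 = {?T}" "Qs 1 = {?T, D}" "Qs 2 = ?P" by (simp_all add: Qs_def)
  have "Qs i \<subset> Qs (Suc i) \<and> M_ideal (Qs (Suc i)) layer_le (Qs i)" if i: "i < 2" for i
  proof -
    consider "i = 0" "Suc i = 1" | "i = 1" "Suc i = 2" using i by linarith
    then show ?thesis by cases (simp_all only: Q M1 M2 sub1 sub2 simp_thms)
  qed
  moreover have "set_rank ?P layer_le (Qs i) = i" if i: "i \<le> 2" for i
  proof -
    consider "i = 0" | "i = 1" | "i = 2" using i by linarith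
    then show ?thesis by cases (simp_all only: Q rank0 rank1 rank2)
  qed
  ultimately show ?thesis
    unfolding supersolvable_toric_def supersolvable_poset_def bottom_layers
    using Q by (intro exI[of _ Qs] exI[of _ 2]) blast
qed

theorem theorem7p17:
  fixes l :: nat
  assumes "l \<ge> 1"
  shows "supersolvable_toric l (arrB l) \<longleftrightarrow> l \<le> 2"
proof
  show "l \<le> 2" if "supersolvable_toric l (arrB l)"
    using that not_supersolvable_arrB[of l] by force
  show "supersolvable_toric l (arrB l)" if "l \<le> 2"
  proof -
    have "l = 1 \<or> l = 2" using that assms by auto
    then show ?thesis using supersolvable_arrB_1 supersolvable_arrB_2 by blast
  qed
qed

end
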